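(* Let $x^A=x_1^{\alpha_1}\cdots x_N^{\alpha_N}$ with $\alpha_i\ge0$, $\mathbb{R}^N_*=\{x\in\mathbb{R}^N:x_i>0\text{ whenever }\alpha_i>0\}$, and $d\mu_A=\frac{x^Ae^{-|x|^2/2}}{\int_{\mathbb{R}^N_*}x^Ae^{-|x|^2/2}dx}\,dx$ on $\mathbb{R}^N_*$. For all $u\in X_A$, $$\int_{\mathbb{R}^N_*}|\nabla u|^2\,d\mu_A\ge\int_{\mathbb{R}^N_*}\left|u-\int_{\mathbb{R}^N_*}u\,d\mu_A\right|^2d\mu_A.$$ Moreover, if $x^A$ is partial, then equality is attained by some non-constant function $u\in X_A$.
   Context: $N_*$ is the set of $u\in C_0^\infty(\overline{\mathbb{R}^N_*})$ with $\nabla u\cdot\vec\eta=0$ on $\partial\mathbb{R}^N_*$ ($\vec\eta$ the outer normal). $X_A$ is the completion of $N_*$ under the norm $\left(\int|u|^2d\mu_A\right)^{1/2}+\left(\int|\nabla u|^2d\mu_A\right)^{1/2}$. The monomial weight $x^A$ is called full if $\alpha_i>0$ for all $i$, and partial otherwise. *)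

theory Defs
  imports "HOL-Analysis.Analysis"
begin

definition Rstar :: "('n::finite \<Rightarrow> real) \<Rightarrow> (real^'n) set" where
  "Rstar \<alpha> = {x. \<forall>i. \<alpha> i > 0 \<longrightarrow> x $ i > 0}"

definition monomial_weight :: "('n::finite \<Rightarrow> real) \<Rightarrow> real^'n \<Rightarrow> real" where
  "monomial_weight \<alpha> x = (\<Prod>i\<in>UNIV. if \<alpha> i = 0 then 1 else (x $ i) powr (\<alpha> i))"

definition unnorm_density :: "('n::finite \<Rightarrow> real) \<Rightarrow> real^'n \<Rightarrow> real" where
  "unnorm_density \<alpha> x = indicator (Rstar \<alpha>) x * monomial_weight \<alpha> x * exp (- (norm x)\<^sup>2 / 2)"

definition norm_const :: "('n::finite \<Rightarrow> real) \<Rightarrow> real" where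
  "norm_const \<alpha> = integral\<^sup>L lborel (unnorm_density \<alpha>)"

definition mu_A :: "('n::finite \<Rightarrow> real) \<Rightarrow> (real^'n) measure" where
  "mu_A \<alpha> = density lborel (\<lambda>x. ennreal (unnorm_density \<alpha> x / norm_const \<alpha>))"

definition pderiv_i :: "'n::finite \<Rightarrow> (real^'n \<Rightarrow> real) \<Rightarrow> real^'n \<Rightarrow> real" where
  "pderiv_i i f x = frechet_derivative f (at x) (axis i 1)"

definition grad :: "(real^'n::finite \<Rightarrow> real) \<Rightarrow> real^'n \<Rightarrow> real^'n" where
  "grad f x = (\<chi> i. pderiv_i i f x)"

definition smooth :: "(real^'n::finite \<Rightarrow> real) \<Rightarrow> bool" where
  "smooth f \<longleftrightarrow> (\<forall>is :: 'n list. \<forall>x. (foldr pderiv_i is f) differentiable (at x))"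

text \<open>The class N_*: (restrictions to the closure of R^N_* of) smooth compactly supported
  functions satisfying the Neumann condition on the boundary of R^N_*: the outer normal
  at a boundary point with x_i = 0 is -e_i, so the condition is d_i u = 0 there.\<close>
definition N_star :: "('n::finite \<Rightarrow> real) \<Rightarrow> (real^'n \<Rightarrow> real) set" where
  "N_star \<alpha> = {u. smooth u \<and> compact (closure {x. u x \<noteq> 0}) \<and>
     (\<forall>x\<in>closure (Rstar \<alpha>). \<forall>i. \<alpha> i > 0 \<and> x $ i = 0 \<longrightarrow> pderiv_i i u x = 0)}"

text \<open>X_A, the completion of N_* in the norm ||u||_{L^2(mu_A)} + ||grad u||_{L^2(mu_A)},
  realised concretely as the pairs (u, g) in L^2(mu_A) x L^2(mu_A;R^N) that are limits of
  (u_k, grad u_k) with u_k in N_*; g plays the role of grad u.\<close>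
definition X_A :: "('n::finite \<Rightarrow> real) \<Rightarrow> ((real^'n \<Rightarrow> real) \<times> (real^'n \<Rightarrow> real^'n)) set" where
  "X_A \<alpha> = {(u, g). u \<in> borel_measurable (mu_A \<alpha>) \<and> g \<in> borel_measurable (mu_A \<alpha>) \<and>
     (\<integral>\<^sup>+ x. ennreal ((u x)\<^sup>2) \<partial>mu_A \<alpha>) < \<infinity> \<and>
     (\<integral>\<^sup>+ x. ennreal ((norm (g x))\<^sup>2) \<partial>mu_A \<alpha>) < \<infinity> \<and>
     (\<exists>uk :: nat \<Rightarrow> real^'n \<Rightarrow> real. (\<forall>k. uk k \<in> N_star \<alpha>) \<and>
        (\<lambda>k. \<integral>\<^sup>+ x. ennreal ((uk k x - u x)\<^sup>2) \<partial>mu_A \<alpha>) \<longlonglongrightarrow> 0 \<and>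
        (\<lambda>k. \<integral>\<^sup>+ x. ennreal ((norm (grad (uk k) x - g x))\<^sup>2) \<partial>mu_A \<alpha>) \<longlonglongrightarrow> 0)}"

end

theory Submission
  imports Defs "HOL-Probability.Distributions" "HOL-Probability.Infinite_Product_Measure"
begin

text \<open>
  The measure \<open>\<mu>\<^sub>A\<close> is the product of the probability measures with densities
  \<open>\<rho>\<close> proportional to \<open>t powr \<alpha>\<^sub>i * exp (- t\<^sup>2 / 2)\<close>, so by tensorization of the variance
  it suffices to prove the one-dimensional inequality. There, writing \<open>f x - f y\<close> as an integral
  of \<open>f'\<close> gives \<open>Var f \<le> \<integral> f'(t)\<^sup>2 S(t) dt\<close> with \<open>S(t) = \<integral>\<^sub>t\<^sup>\<infinity> (x - m) \<rho>(x) dx\<close>, and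
  \<open>S \<le> \<rho>\<close> follows from \<open>\<rho>' = (\<alpha>\<^sub>i / x - x) \<rho>\<close>, because \<open>\<alpha>\<^sub>i / x\<close> is decreasing. If
  \<open>\<alpha>\<^sub>i = 0\<close>, the \<open>i\<close>-th factor is the standard Gaussian and the coordinate \<open>x\<^sub>i\<close>, the limit of
  radial truncations in \<open>N\<^sub>*\<close>, has variance one and a gradient of norm one.
\<close>

section \<open>A one-dimensional Poincare inequality\<close>

text \<open>The quotient \<open>S(t) / \<rho>(t)\<close> is the Stein kernel of the one-dimensional
  density. It equals one for the Gaussian, and a power weight can only lower it, which is why the
  constant is one for all exponents; tensorization then adds the one-dimensional energies without
  loss in the dimension. The kernel arises from twice the variance, written as the integral of
  \<open>(f x - f y)\<^sup>2\<close> over independent pairs: Cauchy-Schwarz on the segment costs a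
  factor \<open>|x - y|\<close>, and exchanging the integrals leaves at \<open>t\<close> the mean of
  \<open>|x - y|\<close> over the pairs separated by \<open>t\<close>, which is
  \<open>2 * S t\<close>. The obstacle is the boundary point 0, where \<open>a / x\<close> is
  singular and, for exponents between 0 and 1, the derivative of the weight is unbounded. Identities
  for the weight are therefore used on compact intervals away from 0 and passed to the
  limit.\<close>

lemma square_increment_le_integral_deriv:
  fixes f f' :: "real \<Rightarrow> real"
  assumes der: "\<And>x. (f has_real_derivative f' x) (at x)" and cont: "continuous_on UNIV f'"
    and "y < x"
  shows "ennreal ((f x - f y)\<^sup>2) \<le> ennreal (x - y) * (\<integral>\<^sup>+t. ennreal ((f' t)\<^sup>2) * indicator {y..<x} t \<partial>lborel)"
proof -
  \<comment> \<open>The mean slope. Cauchy-Schwarz appears here as nonnegativity of the integral of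
    \<open>(f' t - c)\<^sup>2\<close>.\<close>
  define c where "c = (f x - f y) / (x - y)"
  have i1: "has_bochner_integral lborel (\<lambda>t. indicator {y..x} t *\<^sub>R f' t) (f x - f y)"
    using assms by (intro has_bochner_integral_FTC_Icc)
      (auto simp: has_real_derivative_iff_has_vector_derivative[symmetric]
        intro: has_field_derivative_at_within continuous_on_subset)
  have i2: "set_integrable lborel {y..x} (\<lambda>t. (f' t)\<^sup>2)"
    by (intro borel_integrable_atLeastAtMost' continuous_intros continuous_on_subset[OF cont]) auto
  have i3: "set_integrable lborel {y..x} (\<lambda>t. c)"
    by (intro borel_integrable_atLeastAtMost' continuous_intros)
  have "0 \<le> (LINT t:{y..x}|lborel. (f' t - c)\<^sup>2)"
    unfolding set_lebesgue_integral_def by (intro integral_nonneg_AE) auto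
  also have "\<dots> = (LINT t|lborel. indicator {y..x} t *\<^sub>R (f' t)\<^sup>2 - 2 * c * (indicator {y..x} t *\<^sub>R f' t) + c * (indicator {y..x} t *\<^sub>R c))"
    unfolding set_lebesgue_integral_def
    by (intro Bochner_Integration.integral_cong) (auto simp: power2_eq_square algebra_simps split: split_indicator)
  also have "\<dots> = (LINT t:{y..x}|lborel. (f' t)\<^sup>2) - 2 * c * (f x - f y) + c * (c * (x - y))"
    using i1 i2 i3 \<open>y < x\<close> unfolding set_integrable_def set_lebesgue_integral_def
    by (subst Bochner_Integration.integral_add Bochner_Integration.integral_diff,
        auto simp: has_bochner_integral_iff)+
  also have "\<dots> = (LINT t:{y..x}|lborel. (f' t)\<^sup>2) - (f x - f y)\<^sup>2 / (x - y)"
  proof -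
    have "2 * c * (f x - f y) = 2 * ((f x - f y)\<^sup>2 / (x - y))"
      "c * (c * (x - y)) = (f x - f y)\<^sup>2 / (x - y)"
      using \<open>y < x\<close> by (simp_all add: c_def power2_eq_square)
    then show ?thesis by linarith
  qed
  finally have "(f x - f y)\<^sup>2 \<le> (x - y) * (LINT t:{y..x}|lborel. (f' t)\<^sup>2)"
    using \<open>y < x\<close> by (simp add: field_simps)
  then have "ennreal ((f x - f y)\<^sup>2) \<le> ennreal (x - y) * ennreal (LINT t:{y..x}|lborel. (f' t)\<^sup>2)"
    using \<open>y < x\<close> by (subst ennreal_mult'[symmetric]) (auto intro: ennreal_leI)
  also have "ennreal (LINT t:{y..x}|lborel. (f' t)\<^sup>2) = (\<integral>\<^sup>+t. ennreal (indicator {y..x} t *\<^sub>R (f' t)\<^sup>2) \<partial>lborel)"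
    using i2 unfolding set_integrable_def set_lebesgue_integral_def
    by (intro nn_integral_eq_integral[symmetric]) auto
  \<comment> \<open>The half-open interval matches the separation condition
    \<open>y \<le> t < x\<close>, which is how the kernel \<open>k\<close> of the main argument
    splits the pairs at \<open>t\<close>.\<close>
  also have "\<dots> = (\<integral>\<^sup>+t. ennreal ((f' t)\<^sup>2) * indicator {y..<x} t \<partial>lborel)"
    using AE_lborel_singleton[of x]
    by (intro nn_integral_cong_AE) (auto split: split_indicator)
  finally show ?thesis .
qed

text \<open>Subtracting an independent copy removes the mean: the two squares contribute equally and
  the cross term is the squared mean. The left side is kept as an iterated nonnegative integral,
  ready for Tonelli.\<close>

lemma (in prob_space) integral_square_diff_iterated:
  fixes f :: "'a \<Rightarrow> real"
  assumes [measurable]: "f \<in> borel_measurable M" and b: "\<And>x. \<bar>f x\<bar> \<le> B"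
  shows "(\<integral>\<^sup>+x. \<integral>\<^sup>+y. ennreal ((f x - f y)\<^sup>2) \<partial>M \<partial>M) = ennreal (2 * (\<integral>x. (f x - (\<integral>y. f y \<partial>M))\<^sup>2 \<partial>M))"
proof -
  have B0: "0 \<le> B" using b[of undefined] by linarith
  have b2: "\<bar>(f x)\<^sup>2\<bar> \<le> B\<^sup>2" for x using b[of x] B0 by (simp add: abs_le_square_iff[symmetric])
  have [simp]: "integrable M f" by (rule integrable_const_bound[of _ B]) (auto simp: b)
  have [simp]: "integrable M (\<lambda>x. (f x)\<^sup>2)" by (rule integrable_const_bound[of _ "B\<^sup>2"]) (use b2 in auto)
  define e where "e = (\<integral>y. f y \<partial>M)"
  define q where "q = (\<integral>y. (f y)\<^sup>2 \<partial>M)"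
  have exp: "(f x - c)\<^sup>2 = (f x)\<^sup>2 - (2 * c) * f x + c\<^sup>2" for x c
    by (simp add: power2_eq_square algebra_simps)
  have inner: "(\<integral>y. (f x - f y)\<^sup>2 \<partial>M) = (f x)\<^sup>2 - 2 * e * f x + q" for x
    unfolding power2_commute[of "f x"] exp by (simp add: prob_space e_def q_def)
  have "(\<integral>\<^sup>+x. \<integral>\<^sup>+y. ennreal ((f x - f y)\<^sup>2) \<partial>M \<partial>M) = (\<integral>\<^sup>+x. ennreal ((f x)\<^sup>2 - 2 * e * f x + q) \<partial>M)"
    unfolding inner[symmetric]
  proof (intro nn_integral_cong nn_integral_eq_integral)
    show "integrable M (\<lambda>y. (f x - f y)\<^sup>2)" for x
      unfolding power2_commute[of "f x"] exp by simp
  qed auto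
  also have "\<dots> = ennreal (\<integral>x. (f x)\<^sup>2 - 2 * e * f x + q \<partial>M)"
  proof (intro nn_integral_eq_integral AE_I2)
    show "0 \<le> (f x)\<^sup>2 - 2 * e * f x + q" for x
      unfolding inner[symmetric] by simp
  qed simp
  also have "(\<integral>x. (f x)\<^sup>2 - 2 * e * f x + q \<partial>M) = 2 * (\<integral>x. (f x - e)\<^sup>2 \<partial>M)"
  proof -
    have "(\<integral>x. (f x)\<^sup>2 - 2 * e * f x + q \<partial>M) = 2 * q - 2 * e\<^sup>2"
      "(\<integral>x. (f x - e)\<^sup>2 \<partial>M) = q - e\<^sup>2"
      unfolding exp by (simp_all add: prob_space q_def[symmetric] e_def[symmetric]) (simp_all add: power2_eq_square)
    then show ?thesis by simp
  qed
  finally show ?thesis unfolding e_def .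
qed

text \<open>The tail hypothesis bounds the Stein kernel of \<open>\<rho>\<close> by one. Isolating
  it here keeps the double-integral argument free of the particular weights.\<close>

lemma poincare_from_tail_bound:
  fixes \<rho> f f' :: "real \<Rightarrow> real" and m :: real
  assumes nn: "\<And>x. 0 \<le> \<rho> x"
    and i0: "integrable lborel \<rho>" and one: "(\<integral>x. \<rho> x \<partial>lborel) = 1"
    and i1: "integrable lborel (\<lambda>x. x * \<rho> x)" and mean: "(\<integral>x. x * \<rho> x \<partial>lborel) = m"
    and tail: "\<And>t. (\<integral>x. indicator {t<..} x * ((x - m) * \<rho> x) \<partial>lborel) \<le> \<rho> t"
    and der: "\<And>x. (f has_real_derivative f' x) (at x)" and cont: "continuous_on UNIV f'"
    and fb: "\<And>x. \<bar>f x\<bar> \<le> B" and f'b: "\<And>x. \<bar>f' x\<bar> \<le> B'"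
  defines "M \<equiv> density lborel (\<lambda>x. ennreal (\<rho> x))"
  shows "(\<integral>x. (f x - (\<integral>y. f y \<partial>M))\<^sup>2 \<partial>M) \<le> (\<integral>x. (f' x)\<^sup>2 \<partial>M)"
proof -
  have [measurable]: "\<rho> \<in> borel_measurable borel" using i0 by auto
  have [measurable]: "f' \<in> borel_measurable borel" using cont by (simp add: borel_measurable_continuous_onI)
  have "continuous_on UNIV f" using der by (meson DERIV_continuous_on has_field_derivative_at_within)
  then have [measurable]: "f \<in> borel_measurable borel" by (simp add: borel_measurable_continuous_onI)
  interpret prob_space M
  proof
    have "emeasure M (space M) = (\<integral>\<^sup>+x. ennreal (\<rho> x) \<partial>lborel)"
      by (simp add: M_def emeasure_density)
    also have "\<dots> = 1" using nn i0 one by (subst nn_integral_eq_integral) auto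
    finally show "emeasure M (space M) = 1" .
  qed
  have [measurable_cong]: "sets M = sets borel" by (simp add: M_def)
  have intM: "integrable M g \<longleftrightarrow> integrable lborel (\<lambda>x. \<rho> x * g x)" if [measurable]: "g \<in> borel_measurable borel" for g :: "real \<Rightarrow> real"
    unfolding M_def using nn by (subst integrable_density) auto
  have intgM: "integral\<^sup>L M g = (\<integral>x. \<rho> x * g x \<partial>lborel)" if [measurable]: "g \<in> borel_measurable borel" for g :: "real \<Rightarrow> real"
    unfolding M_def using nn by (subst integral_density) auto
  have ix[simp]: "integrable M (\<lambda>x. x)" using i1 by (subst intM) (auto simp: mult.commute)
  have mx: "(\<integral>x. x \<partial>M) = m" by (subst intgM) (auto simp: mean[symmetric] mult.commute)
  have intind[simp]: "integrable M (\<lambda>x. indicator A x * x)" "integrable M (indicator A :: real \<Rightarrow> real)" if [measurable]: "A \<in> sets borel" for A :: "real set"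
  proof -
    show "integrable M (\<lambda>x. indicator A x * x)"
      by (rule Bochner_Integration.integrable_bound[OF ix]) (auto split: split_indicator)
    show "integrable M (indicator A :: real \<Rightarrow> real)"
      by (rule integrable_const_bound[of _ 1]) (auto split: split_indicator)
  qed
  \<comment> \<open>\<open>k x y t\<close> is the distance of \<open>x\<close> and \<open>y\<close>
    if \<open>t\<close> separates the two points, and 0 otherwise. Products of a function of
    \<open>x\<close> with a function of \<open>y\<close> let the double integral factor into
    one-dimensional ones.\<close>
  define k :: "real \<Rightarrow> real \<Rightarrow> real \<Rightarrow> real" where "k x y t =
    indicator {..t} y * (indicator {t<..} x * (x - y)) + indicator {t<..} y * (indicator {..t} x * (y - x))" for x y t
  have k0: "0 \<le> k x y t" for x y t by (auto simp: k_def split: split_indicator)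
  have [measurable (raw)]: "(\<lambda>z. k (a z) (b z) (c z)) \<in> borel_measurable N"
    if [measurable]: "a \<in> borel_measurable N" "b \<in> borel_measurable N" "c \<in> borel_measurable N" for a b c and N :: "'z measure"
  proof -
    \<comment> \<open>The sets inside the indicators move with \<open>t\<close>; rephrasing them as
      comparisons gives joint measurability in all three arguments, as Tonelli requires.\<close>
    have "(\<lambda>z. k (a z) (b z) (c z)) = (\<lambda>z. if b z \<le> c z \<and> c z < a z then a z - b z else if c z < b z \<and> a z \<le> c z then b z - a z else 0)"
      by (auto simp: k_def fun_eq_iff split: split_indicator)
    then show ?thesis by simp
  qed
  have step: "ennreal ((f x - f y)\<^sup>2) \<le> (\<integral>\<^sup>+t. ennreal (k x y t) * ennreal ((f' t)\<^sup>2) \<partial>lborel)" for x y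
  proof -
    have *: "ennreal ((f x - f y)\<^sup>2) \<le> (\<integral>\<^sup>+t. ennreal (k x y t) * ennreal ((f' t)\<^sup>2) \<partial>lborel) \<and>
       ennreal ((f x - f y)\<^sup>2) \<le> (\<integral>\<^sup>+t. ennreal (k y x t) * ennreal ((f' t)\<^sup>2) \<partial>lborel)" if "y < x" for x y
    proof -
      have 1: "ennreal (k x y t) * ennreal ((f' t)\<^sup>2) = ennreal (x - y) * (ennreal ((f' t)\<^sup>2) * indicator {y..<x} t)" for t
        using that by (auto simp: k_def split: split_indicator)
      have 2: "k y x t = k x y t" for t by (auto simp: k_def)
      show ?thesis unfolding 2 1 using square_increment_le_integral_deriv[OF der cont that]
        by (simp add: nn_integral_cmult)
    qed
    from *[of y x] *[of x y] show ?thesis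
      by (cases "x < y"; cases "x = y") (auto simp: power2_commute)
  qed
  define S where "S t = (\<integral>x. indicator {t<..} x * ((x - m) * \<rho> x) \<partial>lborel)" for t
  \<comment> \<open>Each half of the kernel has mean \<open>P * F - G * Q\<close>. Since
    \<open>Q = m - P\<close> and \<open>F = 1 - G\<close>, this is \<open>P - m * G\<close>, the
    integral of \<open>x - m\<close> over the tail beyond \<open>t\<close>.\<close>
  have kernel: "(\<integral>\<^sup>+x. \<integral>\<^sup>+y. ennreal (k x y t) \<partial>M \<partial>M) = ennreal (2 * S t)" for t
  proof -
    define P where "P = (\<integral>x. indicator {t<..} x * x \<partial>M)"
    define Q where "Q = (\<integral>x. indicator {..t} x * x \<partial>M)"
    define F where "F = (\<integral>x. indicator {..t} x \<partial>M :: real)"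
    define G where "G = (\<integral>x. indicator {t<..} x \<partial>M :: real)"
    have "P + Q = (\<integral>x. indicator {t<..} x * x + indicator {..t} x * x \<partial>M)"
      unfolding P_def Q_def by (rule Bochner_Integration.integral_add[symmetric]) auto
    also have "\<dots> = m" unfolding mx[symmetric] by (intro Bochner_Integration.integral_cong) (auto split: split_indicator)
    finally have PQ: "Q = m - P" by simp
    have "F + G = (\<integral>x. indicator {..t} x + indicator {t<..} x \<partial>M)"
      unfolding F_def G_def by (rule Bochner_Integration.integral_add[symmetric]) auto
    also have "\<dots> = (\<integral>x. 1 \<partial>M)" by (intro Bochner_Integration.integral_cong) (auto split: split_indicator)
    finally have FG: "F = 1 - G" by (simp add: prob_space)
    have keq: "k x y t = (indicator {t<..} x * x) * indicator {..t} y - indicator {t<..} x * (indicator {..t} y * y)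
       + (indicator {..t} x * (indicator {t<..} y * y) - (indicator {..t} x * x) * indicator {t<..} y)" for x y
      by (auto simp: k_def split: split_indicator)
    have ik: "integrable M (\<lambda>y. k x y t)" "(\<integral>y. k x y t \<partial>M) = (indicator {t<..} x * x) * F - indicator {t<..} x * Q
       + (indicator {..t} x * P - (indicator {..t} x * x) * G)" for x
      unfolding keq F_def G_def P_def Q_def by simp_all
    have inn: "(\<integral>\<^sup>+y. ennreal (k x y t) \<partial>M) = ennreal ((indicator {t<..} x * x) * F - indicator {t<..} x * Q
       + (indicator {..t} x * P - (indicator {..t} x * x) * G))" for x
      unfolding ik(2)[symmetric] using k0 ik(1) by (intro nn_integral_eq_integral) auto
    have pos: "0 \<le> (indicator {t<..} x * x) * F - indicator {t<..} x * Q
       + (indicator {..t} x * P - (indicator {..t} x * x) * G)" for x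
      unfolding ik(2)[symmetric] using k0 by (intro integral_nonneg_AE) auto
    have "(\<integral>\<^sup>+x. \<integral>\<^sup>+y. ennreal (k x y t) \<partial>M \<partial>M) = ennreal (\<integral>x. (indicator {t<..} x * x) * F - indicator {t<..} x * Q
       + (indicator {..t} x * P - (indicator {..t} x * x) * G) \<partial>M)"
      unfolding inn using pos by (intro nn_integral_eq_integral) simp_all
    also have "(\<integral>x. (indicator {t<..} x * x) * F - indicator {t<..} x * Q
       + (indicator {..t} x * P - (indicator {..t} x * x) * G) \<partial>M) = P * F - G * Q + (F * P - Q * G)"
      by (simp add: P_def Q_def F_def G_def)
    also have "\<dots> = 2 * (P - m * G)" by (simp add: PQ FG algebra_simps)
    also have "P - m * G = (\<integral>x. indicator {t<..} x * x - m * indicator {t<..} x \<partial>M)"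
      by (simp add: P_def G_def)
    also have "\<dots> = S t"
      unfolding S_def by (subst intgM) (auto intro!: Bochner_Integration.integral_cong simp: algebra_simps split: split_indicator)
    finally show ?thesis .
  qed
  have "ennreal (2 * (\<integral>x. (f x - (\<integral>y. f y \<partial>M))\<^sup>2 \<partial>M)) = (\<integral>\<^sup>+x. \<integral>\<^sup>+y. ennreal ((f x - f y)\<^sup>2) \<partial>M \<partial>M)"
    by (rule integral_square_diff_iterated[symmetric, OF _ fb]) simp
  also have "\<dots> \<le> (\<integral>\<^sup>+x. \<integral>\<^sup>+y. \<integral>\<^sup>+t. ennreal (k x y t) * ennreal ((f' t)\<^sup>2) \<partial>lborel \<partial>M \<partial>M)"
    by (intro nn_integral_mono step)
  also have "\<dots> = (\<integral>\<^sup>+x. \<integral>\<^sup>+t. \<integral>\<^sup>+y. ennreal (k x y t) * ennreal ((f' t)\<^sup>2) \<partial>M \<partial>lborel \<partial>M)"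
  proof (intro nn_integral_cong)
    interpret pair_sigma_finite M lborel ..
    show "(\<integral>\<^sup>+y. \<integral>\<^sup>+t. ennreal (k x y t) * ennreal ((f' t)\<^sup>2) \<partial>lborel \<partial>M) =
        (\<integral>\<^sup>+t. \<integral>\<^sup>+y. ennreal (k x y t) * ennreal ((f' t)\<^sup>2) \<partial>M \<partial>lborel)" for x
      by (rule Fubini'[symmetric]) simp
  qed
  also have "\<dots> = (\<integral>\<^sup>+t. \<integral>\<^sup>+x. \<integral>\<^sup>+y. ennreal (k x y t) * ennreal ((f' t)\<^sup>2) \<partial>M \<partial>M \<partial>lborel)"
  proof -
    interpret pair_sigma_finite M lborel ..
    have "(\<lambda>(x, t). \<integral>\<^sup>+y. ennreal (k x y t) * ennreal ((f' t)\<^sup>2) \<partial>M) \<in> borel_measurable (borel \<Otimes>\<^sub>M borel)"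
    proof -
      have "(\<lambda>p. \<integral>\<^sup>+y. ennreal (k (fst p) y (snd p)) * ennreal ((f' (snd p))\<^sup>2) \<partial>M) \<in> borel_measurable (borel \<Otimes>\<^sub>M borel)"
        by measurable
      then show ?thesis by (simp add: split_beta')
    qed
    then show ?thesis by (intro Fubini'[symmetric]) (simp cong: measurable_cong_sets)
  qed
  also have "\<dots> = (\<integral>\<^sup>+t. ennreal (2 * S t) * ennreal ((f' t)\<^sup>2) \<partial>lborel)"
    by (simp add: nn_integral_multc kernel)
  also have "\<dots> \<le> (\<integral>\<^sup>+t. ennreal (\<rho> t) * ennreal (2 * (f' t)\<^sup>2) \<partial>lborel)"
  proof (intro nn_integral_mono)
    fix t
    have "ennreal (2 * S t) * ennreal ((f' t)\<^sup>2) \<le> ennreal (2 * \<rho> t) * ennreal ((f' t)\<^sup>2)"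
      using tail[of t] by (intro mult_right_mono ennreal_leI) (auto simp: S_def)
    also have "\<dots> = ennreal (\<rho> t) * ennreal (2 * (f' t)\<^sup>2)"
      using nn[of t] by (simp add: ennreal_mult'[symmetric] mult_ac)
    finally show "ennreal (2 * S t) * ennreal ((f' t)\<^sup>2) \<le> ennreal (\<rho> t) * ennreal (2 * (f' t)\<^sup>2)" .
  qed
  also have "\<dots> = (\<integral>\<^sup>+t. ennreal (2 * (f' t)\<^sup>2) \<partial>M)"
    unfolding M_def by (subst nn_integral_density) auto
  also have "\<dots> = ennreal (\<integral>t. 2 * (f' t)\<^sup>2 \<partial>M)"
  proof (intro nn_integral_eq_integral integrable_const_bound[of _ "2 * B'\<^sup>2"] AE_I2)
    show "norm (2 * (f' x)\<^sup>2) \<le> 2 * B'\<^sup>2" for x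
      using f'b[of x] by (simp add: abs_le_square_iff[symmetric])
  qed auto
  finally have "2 * (\<integral>x. (f x - (\<integral>y. f y \<partial>M))\<^sup>2 \<partial>M) \<le> (\<integral>t. 2 * (f' t)\<^sup>2 \<partial>M)"
    by (subst (asm) ennreal_le_iff) auto
  then show ?thesis by simp
qed

section \<open>Tensorization of the variance\<close>

lemma (in prob_space) integrable_bounded:
  fixes f :: "'a \<Rightarrow> real"
  assumes "f \<in> borel_measurable M" "\<And>x. x \<in> space M \<Longrightarrow> \<bar>f x\<bar> \<le> B"
  shows "integrable M f"
  using assms by (intro integrable_const_bound[of _ B]) auto

lemma (in prob_space) abs_expectation_le:
  fixes f :: "'a \<Rightarrow> real"
  assumes "f \<in> borel_measurable M" "\<And>x. x \<in> space M \<Longrightarrow> \<bar>f x\<bar> \<le> B"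
  shows "\<bar>\<integral>x. f x \<partial>M\<bar> \<le> B"
proof -
  have i: "integrable M f" by (rule integrable_bounded[OF assms])
  have "\<bar>\<integral>x. f x \<partial>M\<bar> \<le> (\<integral>x. \<bar>f x\<bar> \<partial>M)" by (rule integral_abs_bound)
  also have "\<dots> \<le> (\<integral>x. B \<partial>M)"
    using i assms by (intro integral_mono) auto
  finally show ?thesis by (simp add: prob_space)
qed

text \<open>Bias-variance decomposition. It serves to split a variance over two factors, to obtain
  Jensen's inequality (at \<open>c = 0\<close>), and to show that the mean is the best
  centre.\<close>

lemma (in prob_space) integral_square_shift:
  fixes f :: "'a \<Rightarrow> real" and c :: real
  assumes "integrable M f" "integrable M (\<lambda>x. (f x)\<^sup>2)"
  shows "(\<integral>x. (f x - c)\<^sup>2 \<partial>M) = (\<integral>x. (f x - (\<integral>y. f y \<partial>M))\<^sup>2 \<partial>M) + ((\<integral>y. f y \<partial>M) - c)\<^sup>2"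
proof -
  have exp: "(f x - c)\<^sup>2 = (f x)\<^sup>2 - (2 * c) * f x + c\<^sup>2" for x c
    by (simp add: power2_eq_square algebra_simps)
  have "(\<integral>x. (f x - c)\<^sup>2 \<partial>M) = (\<integral>x. (f x)\<^sup>2 \<partial>M) - 2 * c * (\<integral>x. f x \<partial>M) + c\<^sup>2" for c
    unfolding exp using assms by (simp add: prob_space)
  from this[of c] this[of "\<integral>y. f y \<partial>M"] show ?thesis by (simp add: power2_eq_square algebra_simps)
qed

lemma diff_square_le:
  fixes a b B :: real
  assumes "\<bar>a\<bar> \<le> B" "\<bar>b\<bar> \<le> B"
  shows "(a - b)\<^sup>2 \<le> 4 * B\<^sup>2"
proof -
  have "\<bar>a - b\<bar> \<le> \<bar>2 * B\<bar>" using assms by linarith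
  then have "(a - b)\<^sup>2 \<le> (2 * B)\<^sup>2" by (simp only: abs_le_square_iff)
  then show ?thesis by simp
qed

text \<open>The variance is the mean of the conditional variance given the first coordinate plus the
  variance of the conditional mean \<open>g\<close>. Jensen bounds the latter: averaging
  \<open>f (x, y) - h y\<close> over \<open>y\<close> gives \<open>g x - e\<close>, where
  \<open>h\<close> averages out the first coordinate.\<close>

lemma (in pair_prob_space) variance_pair_le:
  fixes f :: "'a \<times> 'b \<Rightarrow> real"
  assumes [measurable]: "f \<in> borel_measurable (M1 \<Otimes>\<^sub>M M2)"
    and b: "\<And>z. z \<in> space (M1 \<Otimes>\<^sub>M M2) \<Longrightarrow> \<bar>f z\<bar> \<le> B"
  shows "(\<integral>z. (f z - (\<integral>w. f w \<partial>(M1 \<Otimes>\<^sub>M M2)))\<^sup>2 \<partial>(M1 \<Otimes>\<^sub>M M2)) \<le>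
    (\<integral>x. (\<integral>y. (f (x, y) - (\<integral>y. f (x, y) \<partial>M2))\<^sup>2 \<partial>M2) \<partial>M1) +
    (\<integral>y. (\<integral>x. (f (x, y) - (\<integral>x. f (x, y) \<partial>M1))\<^sup>2 \<partial>M1) \<partial>M2)"
proof -
  define e where "e = (\<integral>w. f w \<partial>(M1 \<Otimes>\<^sub>M M2))"
  define g where "g x = (\<integral>y. f (x, y) \<partial>M2)" for x
  define h where "h y = (\<integral>x. f (x, y) \<partial>M1)" for y
  have [measurable]: "g \<in> borel_measurable M1" "h \<in> borel_measurable M2"
    by (simp_all add: g_def[abs_def] h_def[abs_def])
  have b': "\<bar>f (x, y)\<bar> \<le> B" if "x \<in> space M1" "y \<in> space M2" for x y
    using b[of "(x, y)"] that by (simp add: space_pair_measure)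
  have gb: "\<bar>g x\<bar> \<le> B" if "x \<in> space M1" for x
    unfolding g_def using that b' by (intro M2.abs_expectation_le) auto
  have hb: "\<bar>h y\<bar> \<le> B" if "y \<in> space M2" for y
    unfolding h_def using that b' by (intro M1.abs_expectation_le) auto
  have eb: "\<bar>e\<bar> \<le> B"
    unfolding e_def by (intro P.abs_expectation_le b) auto
  have fi: "integrable (M1 \<Otimes>\<^sub>M M2) f" by (rule P.integrable_bounded[OF _ b]) auto
  have eg: "e = (\<integral>x. g x \<partial>M1)" unfolding e_def g_def
    by (rule integral_fst'[OF fi, symmetric])
  have eh: "e = (\<integral>y. h y \<partial>M2)" unfolding e_def h_def
    using integral_snd[of "\<lambda>x y. f (x, y)"] fi by simp
  have int2: "integrable M2 (\<lambda>y. f (x, y))" "integrable M2 (\<lambda>y. (f (x, y))\<^sup>2)" if "x \<in> space M1" for x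
  proof -
    show "integrable M2 (\<lambda>y. f (x, y))"
      using b'[OF that] that by (intro M2.integrable_bounded[of _ B]) auto
    \<comment> \<open>\<open>eb\<close> supplies \<open>0 \<le> B\<close>, so that
      \<open>diff_square_le\<close> applies with second entry 0; its factor 4 is harmless, as any
      bound will do.\<close>
    show "integrable M2 (\<lambda>y. (f (x, y))\<^sup>2)"
      using diff_square_le[OF b'[OF that], of _ 0] eb that
      by (intro M2.integrable_bounded[of _ "4 * B\<^sup>2"]) auto
  qed
  have inth: "integrable M2 h" by (rule M2.integrable_bounded[OF _ hb]) auto
  define k where "k x y = (f (x, y) - h y)\<^sup>2" for x y
  have ki: "integrable (M1 \<Otimes>\<^sub>M M2) (\<lambda>(x, y). k x y)"
  proof (rule P.integrable_bounded)
    fix z assume "z \<in> space (M1 \<Otimes>\<^sub>M M2)"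
    then show "\<bar>case z of (x, y) \<Rightarrow> k x y\<bar> \<le> 4 * B\<^sup>2"
      using diff_square_le[OF b' hb] unfolding k_def by (cases z) (auto simp: space_pair_measure)
  qed (simp add: k_def[abs_def] split_beta')
  have jensen: "(g x - e)\<^sup>2 \<le> (\<integral>y. k x y \<partial>M2)" if x: "x \<in> space M1" for x
  proof -
    have i1: "integrable M2 (\<lambda>y. f (x, y) - h y)" using int2[OF x] inth by simp
    have i2: "integrable M2 (\<lambda>y. (f (x, y) - h y)\<^sup>2)"
      by (rule M2.integrable_bounded[of _ "4 * B\<^sup>2"]) (use x in \<open>auto intro!: diff_square_le b' hb\<close>)
    have "(\<integral>y. f (x, y) - h y \<partial>M2) = g x - e"
      using int2[OF x] inth by (simp add: g_def eh)
    then show ?thesis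
      using M2.integral_square_shift[OF i1 i2, of 0] by (simp add: k_def)
  qed
  have gei: "integrable M1 (\<lambda>x. (g x - e)\<^sup>2)"
    by (rule M1.integrable_bounded[of _ "4 * B\<^sup>2"]) (auto intro!: diff_square_le gb eb)
  have vi: "integrable M1 (\<lambda>x. \<integral>y. (f (x, y) - g x)\<^sup>2 \<partial>M2)"
    by (rule M1.integrable_bounded[of _ "4 * B\<^sup>2"])
       (auto intro!: order_trans[OF abs_ge_self M2.abs_expectation_le] diff_square_le gb b')
  have "(\<integral>z. (f z - e)\<^sup>2 \<partial>(M1 \<Otimes>\<^sub>M M2)) = (\<integral>x. \<integral>y. (f (x, y) - e)\<^sup>2 \<partial>M2 \<partial>M1)"
    by (rule integral_fst'[symmetric], rule P.integrable_bounded[of _ "4 * B\<^sup>2"])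
       (auto intro!: diff_square_le eb b)
  also have "\<dots> = (\<integral>x. (\<integral>y. (f (x, y) - g x)\<^sup>2 \<partial>M2) + (g x - e)\<^sup>2 \<partial>M1)"
    unfolding g_def by (intro Bochner_Integration.integral_cong refl M2.integral_square_shift int2)
  also have "\<dots> = (\<integral>x. (\<integral>y. (f (x, y) - g x)\<^sup>2 \<partial>M2) \<partial>M1) + (\<integral>x. (g x - e)\<^sup>2 \<partial>M1)"
    by (rule Bochner_Integration.integral_add[OF vi gei])
  also have "(\<integral>x. (g x - e)\<^sup>2 \<partial>M1) \<le> (\<integral>x. \<integral>y. k x y \<partial>M2 \<partial>M1)"
    using integrable_fst'[OF ki] by (intro integral_mono gei jensen) auto
  also have "\<dots> = (\<integral>y. \<integral>x. k x y \<partial>M1 \<partial>M2)"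
    by (rule Fubini_integral[symmetric]) (use ki in simp)
  finally show ?thesis by (simp add: e_def g_def h_def k_def)
qed

text \<open>Induction on the index set, one coordinate being split off by
  \<open>variance_pair_le\<close>. The energies \<open>D i\<close> are arbitrary functions, so no
  derivative enters. The one-coordinate inequality is demanded at every point of the product space,
  hence it survives freezing the new coordinate.\<close>

lemma tensorization:
  fixes f :: "('i \<Rightarrow> 'a) \<Rightarrow> real" and D :: "'i \<Rightarrow> ('i \<Rightarrow> 'a) \<Rightarrow> real"
  assumes M: "\<And>i. prob_space (M i)" and "finite J"
    and "f \<in> borel_measurable (PiM J M)" and "\<And>x. x \<in> space (PiM J M) \<Longrightarrow> \<bar>f x\<bar> \<le> B"
    and "\<And>i. i \<in> J \<Longrightarrow> D i \<in> borel_measurable (PiM J M)"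
    and "\<And>i x. i \<in> J \<Longrightarrow> x \<in> space (PiM J M) \<Longrightarrow> \<bar>D i x\<bar> \<le> B'"
    and "\<And>i x. i \<in> J \<Longrightarrow> x \<in> space (PiM J M) \<Longrightarrow>
      (\<integral>t. (f (x(i := t)) - (\<integral>s. f (x(i := s)) \<partial>M i))\<^sup>2 \<partial>M i) \<le> (\<integral>t. D i (x(i := t)) \<partial>M i)"
  shows "(\<integral>x. (f x - (\<integral>y. f y \<partial>PiM J M))\<^sup>2 \<partial>PiM J M) \<le> (\<Sum>i\<in>J. \<integral>x. D i x \<partial>PiM J M)"
  using assms(2-)
proof (induction J arbitrary: f D rule: finite_induct)
  case empty
  interpret prob_space "PiM {} M" by (rule prob_space_PiM) (rule M)
  have "(\<integral>x. (f x - c)\<^sup>2 \<partial>PiM {} M) = (\<integral>x. (f (\<lambda>x. undefined) - c)\<^sup>2 \<partial>PiM {} M)"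
    "(\<integral>x. f x \<partial>PiM {} M) = (\<integral>x. f (\<lambda>x. undefined) \<partial>PiM {} M)" for c
    by (rule Bochner_Integration.integral_cong; simp add: space_PiM)+
  then show ?case by (simp add: prob_space)
next
  case (insert j J)
  interpret PJ: prob_space "PiM J M" by (rule prob_space_PiM) (rule M)
  interpret Mj: prob_space "M j" by (rule M)
  interpret pair_prob_space "M j" "PiM J M" ..
  let ?I = "insert j J" and ?u = "\<lambda>(t, x). x(j := t)" and ?P = "M j \<Otimes>\<^sub>M PiM J M"
  have upd: "x(j := t) \<in> space (PiM ?I M)" if "x \<in> space (PiM J M)" "t \<in> space (M j)" for x t
    using that by (auto simp: space_PiM PiE_def extensional_def Pi_def)
  have mm: "?u \<in> measurable ?P (PiM ?I M)"
    using measurable_compose[OF measurable_pair_swap' measurable_add_dim] by (simp add: split_beta')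
  have distr_eq: "integral\<^sup>L (PiM ?I M) F = (\<integral>z. F (?u z) \<partial>?P)"
    if [measurable]: "F \<in> borel_measurable (PiM ?I M)" for F :: "_ \<Rightarrow> real"
    by (subst distr_pair_PiM_eq_PiM[of J M j, OF M M, symmetric], subst integral_distr[OF mm]) simp_all
  note fm = measurable_compose[OF mm insert.prems(1)]
  note Dm = measurable_compose[OF mm insert.prems(3)]
  have fm2: "(\<lambda>x. f (x(j := t))) \<in> borel_measurable (PiM J M)" if "t \<in> space (M j)" for t
    using measurable_Pair2[OF fm that] by (simp add: fun_upd_def)
  have Dm2: "(\<lambda>x. D i (x(j := t))) \<in> borel_measurable (PiM J M)" if "i \<in> ?I" "t \<in> space (M j)" for t i
    using measurable_Pair2[OF Dm that(2)] that(1) by (simp add: fun_upd_def)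
  have Di: "integrable ?P (\<lambda>(t, x). D i (x(j := t)))" if "i \<in> ?I" for i
  proof (rule P.integrable_bounded[of _ B'])
    show "(\<lambda>(t, x). D i (x(j := t))) \<in> borel_measurable ?P"
      using Dm[OF that] by (simp add: split_beta' fun_upd_def)
  qed (auto simp: space_pair_measure intro!: insert.prems(4) upd that)
  have Dint: "(\<integral>z. D i z \<partial>PiM ?I M) = (\<integral>t. \<integral>x. D i (x(j := t)) \<partial>PiM J M \<partial>M j)"
    "(\<integral>z. D i z \<partial>PiM ?I M) = (\<integral>x. \<integral>t. D i (x(j := t)) \<partial>M j \<partial>PiM J M)" if "i \<in> ?I" for i
  proof -
    have *: "(\<integral>z. D i z \<partial>PiM ?I M) = (\<integral>(t, x). D i (x(j := t)) \<partial>?P)"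
      using distr_eq[OF insert.prems(3)[OF that]] by (simp add: split_beta' fun_upd_def)
    show "(\<integral>z. D i z \<partial>PiM ?I M) = (\<integral>t. \<integral>x. D i (x(j := t)) \<partial>PiM J M \<partial>M j)"
      unfolding * using integral_fst'[OF Di[OF that]] by simp
    show "(\<integral>z. D i z \<partial>PiM ?I M) = (\<integral>x. \<integral>t. D i (x(j := t)) \<partial>M j \<partial>PiM J M)"
      unfolding * using integral_snd[OF Di[OF that]] by simp
  qed
  define e where "e = (\<integral>y. f y \<partial>PiM ?I M)"
  have e_eq: "e = (\<integral>w. f (?u w) \<partial>?P)"
    unfolding e_def by (rule distr_eq) (rule insert.prems(1))
  have "(\<integral>x. (f x - e)\<^sup>2 \<partial>PiM ?I M) = (\<integral>z. (f (?u z) - e)\<^sup>2 \<partial>?P)"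
    by (rule distr_eq) (use insert.prems(1) in measurable)
  also have "\<dots> \<le> (\<integral>t. \<integral>x. (f (x(j := t)) - (\<integral>x. f (x(j := t)) \<partial>PiM J M))\<^sup>2 \<partial>PiM J M \<partial>M j) +
     (\<integral>x. \<integral>t. (f (x(j := t)) - (\<integral>t. f (x(j := t)) \<partial>M j))\<^sup>2 \<partial>M j \<partial>PiM J M)"
    unfolding e_eq using variance_pair_le[OF fm, of B] upd insert.prems(2)
    by (auto simp: space_pair_measure fun_upd_def)
  also have "(\<integral>t. \<integral>x. (f (x(j := t)) - (\<integral>x. f (x(j := t)) \<partial>PiM J M))\<^sup>2 \<partial>PiM J M \<partial>M j) \<le>
      (\<integral>t. (\<Sum>i\<in>J. \<integral>x. D i (x(j := t)) \<partial>PiM J M) \<partial>M j)"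
  \<comment> \<open>\<open>integral_mono'\<close> asks for integrability of the larger side, and for
    its nonnegativity, which holds because that side dominates a variance.\<close>
  proof (rule integral_mono')
    show "integrable (M j) (\<lambda>t. \<Sum>i\<in>J. \<integral>x. D i (x(j := t)) \<partial>PiM J M)"
      using integrable_fst'[OF Di] by (intro Bochner_Integration.integrable_sum) auto
    fix t assume t: "t \<in> space (M j)"
    show *: "(\<integral>x. (f (x(j := t)) - (\<integral>x. f (x(j := t)) \<partial>PiM J M))\<^sup>2 \<partial>PiM J M)
       \<le> (\<Sum>i\<in>J. \<integral>x. D i (x(j := t)) \<partial>PiM J M)"
    proof (rule insert.IH)
      fix i x assume ix: "i \<in> J" "x \<in> space (PiM J M)"
      then have "i \<noteq> j" using insert.hyps by auto
      show "(\<integral>s. (f ((x(i := s))(j := t)) - (\<integral>s. f ((x(i := s))(j := t)) \<partial>M i))\<^sup>2 \<partial>M i) \<le>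
          (\<integral>s. D i ((x(i := s))(j := t)) \<partial>M i)"
        unfolding fun_upd_twist[OF \<open>i \<noteq> j\<close>] by (rule insert.prems(5)) (use upd[OF ix(2) t] ix(1) in \<open>auto simp: fun_upd_def\<close>)
    qed (use fm2[OF t] Dm2[OF _ t] insert.prems(2)[OF upd[OF _ t]] insert.prems(4)[OF _ upd[OF _ t]]
        in \<open>auto simp: fun_upd_def\<close>)
    show "0 \<le> (\<Sum>i\<in>J. \<integral>x. D i (x(j := t)) \<partial>PiM J M)"
      by (rule order_trans[OF _ *]) simp
  qed
  also have "(\<integral>t. (\<Sum>i\<in>J. \<integral>x. D i (x(j := t)) \<partial>PiM J M) \<partial>M j) = (\<Sum>i\<in>J. \<integral>x. D i x \<partial>PiM ?I M)"
    using integrable_fst'[OF Di] Dint(1) by (subst Bochner_Integration.integral_sum) auto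
  also have "(\<integral>x. \<integral>t. (f (x(j := t)) - (\<integral>t. f (x(j := t)) \<partial>M j))\<^sup>2 \<partial>M j \<partial>PiM J M)
     \<le> (\<integral>x. \<integral>t. D j (x(j := t)) \<partial>M j \<partial>PiM J M)"
  proof (rule integral_mono')
    show "integrable (PiM J M) (\<lambda>x. \<integral>t. D j (x(j := t)) \<partial>M j)"
      using integrable_snd[OF Di[of j]] by simp
    fix x assume x: "x \<in> space (PiM J M)"
    \<comment> \<open>\<open>x\<close> belongs to the product without \<open>j\<close>, so an
      arbitrary \<open>t0\<close> is inserted at \<open>j\<close> to reach a point of the full
      product; updating \<open>j\<close> again erases it.\<close>
    obtain t0 where "t0 \<in> space (M j)" using Mj.not_empty by auto
    then show *: "(\<integral>t. (f (x(j := t)) - (\<integral>t. f (x(j := t)) \<partial>M j))\<^sup>2 \<partial>M j) \<le> (\<integral>t. D j (x(j := t)) \<partial>M j)"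
      using insert.prems(5)[OF insertI1 upd[OF x]] unfolding fun_upd_upd by blast
    show "0 \<le> (\<integral>t. D j (x(j := t)) \<partial>M j)"
      by (rule order_trans[OF _ *]) simp
  qed
  also have "\<dots> = (\<integral>x. D j x \<partial>PiM ?I M)" using Dint(2)[of j] by simp
  finally show ?case using insert.hyps by (simp add: e_def)
qed

section \<open>The one-dimensional weights\<close>

text \<open>Not normalised. For exponent 0 the weight is the Gaussian on the whole line and not on a
  half-line, in accordance with \<open>Rstar\<close>, which constrains a coordinate only if its
  exponent is positive.\<close>

definition gweight :: "real \<Rightarrow> real \<Rightarrow> real" where
  "gweight a x = (if a = 0 then 1 else indicator {0<..} x * x powr a) * exp (- x\<^sup>2 / 2)"

lemma gweight_nonneg[simp]: "0 \<le> gweight a x"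
  by (simp add: gweight_def)

lemma gweight_measurable[measurable]: "gweight a \<in> borel_measurable borel"
  unfolding gweight_def[abs_def] by measurable

lemma gweight_0: "gweight 0 x = sqrt (2 * pi) * std_normal_density x"
  by (simp add: gweight_def normal_density_def)

lemma gweight_eq_0: "a \<noteq> 0 \<Longrightarrow> x \<le> 0 \<Longrightarrow> gweight a x = 0"
  by (simp add: gweight_def)

text \<open>On the positive axis \<open>x powr a \<le> 1 + x ^ n\<close> for an integer
  \<open>n \<ge> a\<close>, by comparison on either side of 1, so absolute moments of the standard
  normal dominate.\<close>

lemma integrable_abs_power_gweight:
  assumes "0 \<le> a"
  shows "integrable lborel (\<lambda>x. \<bar>x\<bar> ^ k * gweight a x)"
proof -
  define n where "n = nat \<lceil>a\<rceil>"
  have n: "a \<le> real n" unfolding n_def by linarith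
  have le: "gweight a x \<le> (1 + \<bar>x\<bar> ^ n) * (sqrt (2 * pi) * std_normal_density x)" for x
  proof -
    have "x powr a \<le> 1 + x ^ n" if "x > 0"
    proof (cases "x \<le> 1")
      case True
      then have "x powr a \<le> 1" using that assms powr_le1[of a x] by simp
      then show ?thesis using that zero_le_power[of x n] by linarith
    next
      case False
      then have "x powr a \<le> x powr real n" using n by (intro powr_mono) auto
      then show ?thesis using that by (simp add: powr_realpow)
    qed
    then have "(if a = 0 then 1 else indicator {0<..} x * x powr a) \<le> 1 + \<bar>x\<bar> ^ n"
      by (auto split: split_indicator)
    from mult_right_mono[OF this, of "exp (- x\<^sup>2 / 2)"] show ?thesis
      unfolding gweight_0[symmetric] by (simp add: gweight_def)
  qed
  have i: "integrable lborel (\<lambda>x. sqrt (2 * pi) * (std_normal_density x * \<bar>x\<bar> ^ k) + sqrt (2 * pi) * (std_normal_density x * \<bar>x\<bar> ^ (k + n)))"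
    by (intro Bochner_Integration.integrable_add integrable_mult_right integrable_std_normal_moment_abs)
  show ?thesis
  proof (rule Bochner_Integration.integrable_bound[OF i], measurable, rule AE_I2)
    fix x :: real
    have "\<bar>x\<bar> ^ k * gweight a x \<le> \<bar>x\<bar> ^ k * ((1 + \<bar>x\<bar> ^ n) * (sqrt (2 * pi) * std_normal_density x))"
      by (intro mult_left_mono le) auto
    also have "\<dots> = sqrt (2 * pi) * (std_normal_density x * \<bar>x\<bar> ^ k) + sqrt (2 * pi) * (std_normal_density x * \<bar>x\<bar> ^ (k + n))"
      by (simp add: algebra_simps power_add)
    finally show "norm (\<bar>x\<bar> ^ k * gweight a x) \<le> norm (sqrt (2 * pi) * (std_normal_density x * \<bar>x\<bar> ^ k) + sqrt (2 * pi) * (std_normal_density x * \<bar>x\<bar> ^ (k + n)))"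
      by (simp add: abs_mult)
  qed
qed

lemma integrable_gweight: "0 \<le> a \<Longrightarrow> integrable lborel (gweight a)"
  using integrable_abs_power_gweight[of a 0] by simp

lemma integrable_ident_gweight:
  assumes "0 \<le> a"
  shows "integrable lborel (\<lambda>x. x * gweight a x)"
  by (rule Bochner_Integration.integrable_bound[OF integrable_abs_power_gweight[OF assms, of 1]]) (auto simp: abs_mult)

text \<open>For every exponent the weight is positive on \<open>{0<..<1}\<close>, which is not a
  null set.\<close>

lemma gweight_integral_pos:
  assumes "0 \<le> a"
  shows "0 < (\<integral>x. gweight a x \<partial>lborel)"
proof -
  have "(\<integral>x. gweight a x \<partial>lborel) \<noteq> 0"
  proof
    assume "(\<integral>x. gweight a x \<partial>lborel) = 0"
    then have "AE x in lborel. gweight a x = 0"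
      using integrable_gweight[OF assms] by (subst (asm) integral_nonneg_eq_0_iff_AE) auto
    then have "AE x in lborel. \<not> (x \<in> {0<..<1::real})"
      by eventually_elim (auto simp: gweight_def split: if_splits)
    then have "{0<..<1::real} \<in> null_sets lborel"
      by (subst (asm) AE_iff_null_sets[symmetric]) auto
    then show False by (simp add: null_sets_def)
  qed
  moreover have "0 \<le> (\<integral>x. gweight a x \<partial>lborel)" by simp
  ultimately show ?thesis by linarith
qed

lemma gweight_deriv:
  assumes "a = 0 \<or> 0 < x"
  shows "(gweight a has_real_derivative (a / x - x) * gweight a x) (at x)"
proof (cases "a = 0")
  case True
  have "((\<lambda>x. exp (- x\<^sup>2 / 2)) has_real_derivative (- x) * exp (- x\<^sup>2 / 2)) (at x)"
    by (auto intro!: derivative_eq_intros)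
  then show ?thesis using True by (simp add: gweight_def[abs_def])
next
  case False
  with assms have x: "0 < x" by simp
  have "((\<lambda>x. x powr a * exp (- x\<^sup>2 / 2)) has_real_derivative (a / x - x) * (x powr a * exp (- x\<^sup>2 / 2))) (at x)"
    using x by (auto intro!: derivative_eq_intros simp: field_simps powr_diff)
  then have "((\<lambda>x. x powr a * exp (- x\<^sup>2 / 2)) has_real_derivative (a / x - x) * gweight a x) (at x)"
    using x False by (simp add: gweight_def)
  then show ?thesis
    by (rule has_field_derivative_transform_within_open[of _ _ _ "{0<..}"]) (use x False in \<open>auto simp: gweight_def\<close>)
qed

text \<open>The antiderivative is \<open>- gweight a\<close>. A positive lower end keeps away from
  0, where for \<open>0 < a < 1\<close> the integrand is unbounded.\<close>

lemma gweight_integral_Icc: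
  assumes "a = 0 \<or> 0 < l" "l \<le> r"
  shows "has_bochner_integral lborel (\<lambda>x. indicator {l..r} x *\<^sub>R ((x - a / x) * gweight a x)) (gweight a l - gweight a r)"
proof -
  have *: "a = 0 \<or> 0 < x" if "x \<in> {l..r}" for x using that assms by auto
  have "has_bochner_integral lborel (\<lambda>x. indicator {l..r} x *\<^sub>R ((x - a / x) * gweight a x)) (- gweight a r - (- gweight a l))"
  proof (rule has_bochner_integral_FTC_Icc[OF assms(2)])
    fix x assume "l \<le> x" "x \<le> r"
    then have "a = 0 \<or> 0 < x" using * by auto
    from DERIV_minus[OF gweight_deriv[OF this]]
    have "((\<lambda>x. - gweight a x) has_real_derivative (x - a / x) * gweight a x) (at x within {l..r})"
      unfolding minus_mult_left minus_diff_eq by (rule has_field_derivative_at_within)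
    then show "((\<lambda>x. - gweight a x) has_vector_derivative (x - a / x) * gweight a x) (at x within {l..r})"
      by (simp add: has_real_derivative_iff_has_vector_derivative)
  next
    have "continuous_on {l..r} (gweight a)"
      using DERIV_isCont[OF gweight_deriv[OF *]] by (intro continuous_at_imp_continuous_on) blast
    moreover have "continuous_on {l..r} (\<lambda>x. a / x)"
      using assms by (cases "a = 0") (auto intro!: continuous_intros)
    ultimately show "continuous_on {l..r} (\<lambda>x. (x - a / x) * gweight a x)"
      by (intro continuous_on_mult continuous_on_diff continuous_on_id)
  qed
  then show ?thesis by simp
qed

text \<open>Where \<open>a / x \<le> m\<close> the integrand on the left is at most \<open>- (gweight a)'\<close>; where \<open>a / x \<ge> m\<close>
  the complementary integral over \<open>(0, t]\<close> is used instead, as the total integral vanishes.\<close>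
lemma gweight_tail:
  assumes a: "0 \<le> a" and mean: "(\<integral>x. (x - m) * gweight a x \<partial>lborel) = 0"
  shows "(\<integral>x. indicator {t<..} x * ((x - m) * gweight a x) \<partial>lborel) \<le> gweight a t"
proof -
  have int: "integrable lborel (\<lambda>x. (x - m) * gweight a x)"
    using integrable_gweight[OF a] integrable_ident_gweight[OF a] by (simp add: left_diff_distrib)
  have inti: "integrable lborel (\<lambda>x. indicator A x * ((x - m) * gweight a x))" if "A \<in> sets borel" for A
    using integrable_mult_indicator[OF _ int, of A] that by simp
  \<comment> \<open>For the Gaussian the centre must be 0 by symmetry; then
    \<open>a / x \<le> m\<close> holds with both sides 0, and the second case below covers every
    \<open>t\<close>.\<close>
  have m0: "m = 0" if "a = 0"
  proof -
    have "(\<integral>x. x * gweight 0 x \<partial>lborel) = sqrt (2 * pi) * (\<integral>x. std_normal_density x * x ^ (2 * 0 + 1) \<partial>lborel)"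
      unfolding gweight_0 integral_mult_right_zero[symmetric] by (intro Bochner_Integration.integral_cong) auto
    also have "\<dots> = 0" by (subst integral_std_normal_moment_odd) simp
    finally have "m * (\<integral>x. gweight 0 x \<partial>lborel) = 0"
      using mean that integrable_gweight[OF a] integrable_ident_gweight[OF a] by (simp add: left_diff_distrib)
    then show ?thesis using gweight_integral_pos[of 0] by simp
  qed
  \<comment> \<open>\<open>a / x\<close> decreases on the positive axis, so its comparison with
    \<open>m\<close> at \<open>t\<close> decides it on a whole side: to the right of
    \<open>t\<close> in the second case, up to \<open>t\<close> in the third. In the first case the
    tail carries the entire weight.\<close>
  consider "a \<noteq> 0" "t \<le> 0" | "a = 0 \<or> 0 < t" "\<And>x. t \<le> x \<Longrightarrow> a / x \<le> m" | "0 < t" "\<And>x. 0 < x \<Longrightarrow> x \<le> t \<Longrightarrow> m \<le> a / x" "a \<noteq> 0"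
  proof (cases "a = 0")
    case True then show ?thesis using m0 that by auto
  next
    case False
    show ?thesis
    proof (cases "t \<le> 0")
      case t: False
      show ?thesis
      \<comment> \<open>This is \<open>a / t \<le> m\<close> in product form; the sign of
        \<open>m\<close> is not known at this point.\<close>
      proof (cases "a \<le> m * t")
        case True
        then have "0 \<le> m * t" using a by linarith
        then have "0 \<le> m" using t by (simp add: zero_le_mult_iff)
        have "a / x \<le> m" if "t \<le> x" for x
          using True that t mult_left_mono[OF that \<open>0 \<le> m\<close>] by (simp add: divide_le_eq)
        then show ?thesis using that(2) t by auto
      next
        case F: False
        have "m \<le> a / x" if "0 < x" "x \<le> t" for x
        proof (cases "0 \<le> m")
          case True
          then show ?thesis using F that mult_left_mono[OF that(2) True] by (simp add: le_divide_eq)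
        next
          case False
          then show ?thesis using a that by (smt (verit) divide_nonneg_pos)
        qed
        then show ?thesis using that(3) t False by auto
      qed
    qed (use that False in auto)
  qed
  then show ?thesis
  proof cases
    case 1
    then have "(\<integral>x. indicator {t<..} x * ((x - m) * gweight a x) \<partial>lborel) = (\<integral>x. (x - m) * gweight a x \<partial>lborel)"
      by (intro Bochner_Integration.integral_cong) (auto simp: gweight_eq_0 split: split_indicator)
    then show ?thesis using mean by simp
  next
    case 2
    show ?thesis
    \<comment> \<open>The fundamental theorem applies on bounded intervals. After truncation at
      \<open>T\<close> the end value \<open>gweight a T\<close> enters with a negative sign and is
      dropped.\<close>
    proof (rule tendsto_upperbound)
      show "((\<lambda>T. \<integral>x. indicator {..T} x *\<^sub>R (indicator {t<..} x * ((x - m) * gweight a x)) \<partial>lborel) \<longlongrightarrow>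
        (\<integral>x. indicator {t<..} x * ((x - m) * gweight a x) \<partial>lborel)) at_top"
        by (rule tendsto_integral_at_top) (auto intro: inti)
      show "\<forall>\<^sub>F T in at_top. (\<integral>x. indicator {..T} x *\<^sub>R (indicator {t<..} x * ((x - m) * gweight a x)) \<partial>lborel) \<le> gweight a t"
        using eventually_ge_at_top[of t]
      proof eventually_elim
        case (elim T)
        note F = gweight_integral_Icc[OF 2(1) elim]
        have "(\<integral>x. indicator {..T} x *\<^sub>R (indicator {t<..} x * ((x - m) * gweight a x)) \<partial>lborel) \<le>
          (\<integral>x. indicator {t..T} x *\<^sub>R ((x - a / x) * gweight a x) \<partial>lborel)"
        proof (rule integral_mono_AE)
          show "integrable lborel (\<lambda>x. indicator {..T} x *\<^sub>R (indicator {t<..} x * ((x - m) * gweight a x)))"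
            using integrable_mult_indicator[OF _ inti[of "{t<..}"], of "{..T}"] by simp
          show "integrable lborel (\<lambda>x. indicator {t..T} x *\<^sub>R ((x - a / x) * gweight a x))"
            using F by (simp add: has_bochner_integral_iff)
          \<comment> \<open>The point \<open>t\<close> has to be excluded: there the left side is 0
            while the right side may be negative.\<close>
          show "AE x in lborel. indicator {..T} x *\<^sub>R (indicator {t<..} x * ((x - m) * gweight a x)) \<le> indicator {t..T} x *\<^sub>R ((x - a / x) * gweight a x)"
            using AE_lborel_singleton[of t]
            by eventually_elim (use 2(2) in \<open>auto intro!: mult_right_mono split: split_indicator\<close>)
        qed
        also have "\<dots> = gweight a t - gweight a T"
          using F by (rule has_bochner_integral_integral_eq)
        also have "\<dots> \<le> gweight a t" by simp
        finally show ?case .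
      qed
    qed simp
  next
    case 3
    have "(\<integral>x. indicator {t<..} x * ((x - m) * gweight a x) \<partial>lborel) + (\<integral>x. indicator {..t} x * ((x - m) * gweight a x) \<partial>lborel)
      = (\<integral>x. indicator {t<..} x * ((x - m) * gweight a x) + indicator {..t} x * ((x - m) * gweight a x) \<partial>lborel)"
      by (rule Bochner_Integration.integral_add[symmetric]) (auto intro: inti)
    also have "\<dots> = (\<integral>x. (x - m) * gweight a x \<partial>lborel)"
      by (intro Bochner_Integration.integral_cong) (auto split: split_indicator)
    finally have eq: "(\<integral>x. indicator {t<..} x * ((x - m) * gweight a x) \<partial>lborel) = - (\<integral>x. indicator {..t} x * ((x - m) * gweight a x) \<partial>lborel)"
      using mean by simp
    also have "\<dots> = (\<integral>x. indicator {..t} x * ((m - x) * gweight a x) \<partial>lborel)"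
      unfolding Bochner_Integration.integral_minus[symmetric] by (intro Bochner_Integration.integral_cong) (auto simp: algebra_simps)
    also have "\<dots> \<le> gweight a t"
    \<comment> \<open>The intervals start at \<open>inverse (Suc n)\<close>, away from 0, and
      exhaust the part of \<open>{..t}\<close> that carries weight. The value of the antiderivative
      at the lower end has a favourable sign.\<close>
    proof (rule LIMSEQ_le_const2)
      show "(\<lambda>n. \<integral>x. indicator {inverse (Suc n)..t} x * ((m - x) * gweight a x) \<partial>lborel) \<longlonglongrightarrow> (\<integral>x. indicator {..t} x * ((m - x) * gweight a x) \<partial>lborel)"
      proof (rule integral_dominated_convergence[OF _ _ integrable_norm[OF int]])
        show "AE x in lborel. (\<lambda>n. indicator {inverse (Suc n)..t} x * ((m - x) * gweight a x)) \<longlonglongrightarrow> indicator {..t} x * ((m - x) * gweight a x)"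
        proof (rule AE_I2)
          fix x :: real
          show "(\<lambda>n. indicator {inverse (Suc n)..t} x * ((m - x) * gweight a x)) \<longlonglongrightarrow> indicator {..t} x * ((m - x) * gweight a x)"
          proof (cases "0 < x")
            case True
            from order_tendstoD(2)[OF LIMSEQ_inverse_real_of_nat True]
            have "\<forall>\<^sub>F n in sequentially. indicator {inverse (Suc n)..t} x * ((m - x) * gweight a x) = indicator {..t} x * ((m - x) * gweight a x)"
              by eventually_elim (auto split: split_indicator)
            then show ?thesis by (rule tendsto_eventually)
          qed (use 3 in \<open>simp add: gweight_eq_0\<close>)
        qed
        show "\<And>n. AE x in lborel. norm (indicator {inverse (Suc n)..t} x * ((m - x) * gweight a x)) \<le> norm ((x - m) * gweight a x)"
          by (auto simp: abs_mult abs_minus_commute split: split_indicator)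
      qed measurable
      show "\<exists>N. \<forall>n\<ge>N. (\<integral>x. indicator {inverse (Suc n)..t} x * ((m - x) * gweight a x) \<partial>lborel) \<le> gweight a t"
      proof -
        have bound: "(\<integral>x. indicator {l..t} x * ((m - x) * gweight a x) \<partial>lborel) \<le> gweight a t" if l: "0 < l" "l \<le> t" for l
        proof -
          have F: "has_bochner_integral lborel (\<lambda>x. - (indicator {l..t} x *\<^sub>R ((x - a / x) * gweight a x))) (- (gweight a l - gweight a t))"
            using l by (intro has_bochner_integral_minus gweight_integral_Icc) auto
          have "(\<integral>x. indicator {l..t} x * ((m - x) * gweight a x) \<partial>lborel) \<le> (\<integral>x. - (indicator {l..t} x *\<^sub>R ((x - a / x) * gweight a x)) \<partial>lborel)"
          proof (rule integral_mono)
            show "integrable lborel (\<lambda>x. indicator {l..t} x * ((m - x) * gweight a x))"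
              using Bochner_Integration.integrable_minus[OF inti[of "{l..t}"]] by (simp add: algebra_simps)
            show "integrable lborel (\<lambda>x. - (indicator {l..t} x *\<^sub>R ((x - a / x) * gweight a x)))"
              using F by (simp add: has_bochner_integral_iff)
            show "indicator {l..t} x * ((m - x) * gweight a x) \<le> - (indicator {l..t} x *\<^sub>R ((x - a / x) * gweight a x))" for x
            proof (cases "x \<in> {l..t}")
              case True
              with 3(2)[of x] l have "(m - x) * gweight a x \<le> (a / x - x) * gweight a x" by (intro mult_right_mono) auto
              then show ?thesis using True by (simp add: algebra_simps)
            qed simp
          qed
          also have "\<dots> = - (gweight a l - gweight a t)"
            using F by (rule has_bochner_integral_integral_eq)
          also have "\<dots> \<le> gweight a t" by simp
          finally show ?thesis .
        qed
        \<comment> \<open>If \<open>inverse (Suc n)\<close> exceeds \<open>t\<close>, the interval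
          is empty and the integral is 0.\<close>
        have "(\<integral>x. indicator {inverse (Suc n)..t} x * ((m - x) * gweight a x) \<partial>lborel) \<le> gweight a t" for n
          by (cases "inverse (real (Suc n)) \<le> t") (auto intro!: bound)
        then show ?thesis by blast
      qed
    qed
    finally show ?thesis .
  qed
qed

section \<open>The product structure of the weighted measure\<close>

definition gmeasure :: "real \<Rightarrow> real measure" where
  "gmeasure a = density lborel (\<lambda>x. ennreal (gweight a x / (\<integral>y. gweight a y \<partial>lborel)))"

lemma sets_gmeasure[simp, measurable_cong]: "sets (gmeasure a) = sets borel"
  by (simp add: gmeasure_def)

lemma space_gmeasure[simp]: "space (gmeasure a) = UNIV"
  by (simp add: gmeasure_def)

lemma prob_space_gmeasure:
  assumes "0 \<le> a"
  shows "prob_space (gmeasure a)"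
proof
  have "emeasure (gmeasure a) (space (gmeasure a)) = (\<integral>\<^sup>+x. ennreal (gweight a x / (\<integral>y. gweight a y \<partial>lborel)) \<partial>lborel)"
    by (simp add: gmeasure_def emeasure_density)
  also have "\<dots> = 1"
    using integrable_gweight[OF assms] gweight_integral_pos[OF assms]
    by (subst nn_integral_eq_integral) auto
  finally show "emeasure (gmeasure a) (space (gmeasure a)) = 1" .
qed

lemma poincare_gmeasure:
  assumes a: "0 \<le> a"
    and der: "\<And>x. (f has_real_derivative f' x) (at x)" and cont: "continuous_on UNIV f'"
    and fb: "\<And>x. \<bar>f x\<bar> \<le> B" and f'b: "\<And>x. \<bar>f' x\<bar> \<le> B'"
  shows "(\<integral>x. (f x - (\<integral>y. f y \<partial>gmeasure a))\<^sup>2 \<partial>gmeasure a) \<le> (\<integral>x. (f' x)\<^sup>2 \<partial>gmeasure a)"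
proof -
  define Z where "Z = (\<integral>y. gweight a y \<partial>lborel)"
  \<comment> \<open>The mean of the normalised density also centres the weight itself, as
    \<open>gweight_tail\<close> requires; dividing that tail bound by \<open>Z\<close> gives the one
    for the density.\<close>
  define m where "m = (\<integral>x. x * (gweight a x / Z) \<partial>lborel)"
  have Z: "Z > 0" unfolding Z_def by (rule gweight_integral_pos[OF a])
  note [simp] = integrable_gweight[OF a] integrable_ident_gweight[OF a]
  have "(\<integral>x. (x - m) * gweight a x \<partial>lborel) = (\<integral>x. x * gweight a x \<partial>lborel) - m * Z"
    by (simp add: left_diff_distrib Z_def)
  also have "\<dots> = 0" using Z by (simp add: m_def)
  finally have mean: "(\<integral>x. (x - m) * gweight a x \<partial>lborel) = 0" .
  have tail: "(\<integral>x. indicator {t<..} x * ((x - m) * (gweight a x / Z)) \<partial>lborel) \<le> gweight a t / Z" for t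
    using divide_right_mono[OF gweight_tail[OF a mean, of t] less_imp_le[OF Z]]
    by simp
  show ?thesis unfolding gmeasure_def Z_def[symmetric]
    using Z by (intro poincare_from_tail_bound[where m=m, OF _ _ _ _ _ _ der cont fb f'b] tail)
      (auto simp: m_def Z_def[symmetric])
qed

lemma norm_vec_square: "(norm (x :: real^'n::finite))\<^sup>2 = (\<Sum>i\<in>UNIV. (x $ i)\<^sup>2)"
  unfolding power2_norm_eq_inner inner_vec_def by (simp add: power2_eq_square)

lemma unnorm_density_eq_prod:
  assumes nonneg: "\<And>i. \<alpha> i \<ge> 0"
  shows "unnorm_density \<alpha> x = (\<Prod>i\<in>UNIV. gweight (\<alpha> i) (x $ i))"
proof -
  have e: "exp (- (norm x)\<^sup>2 / 2) = (\<Prod>i\<in>UNIV. exp (- (x $ i)\<^sup>2 / 2))"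
    by (simp add: norm_vec_square exp_sum[symmetric] sum_negf sum_divide_distrib)
  have m: "indicator (Rstar \<alpha>) x * monomial_weight \<alpha> x =
      (\<Prod>i\<in>UNIV. if \<alpha> i = 0 then 1 else indicator {0<..} (x $ i) * (x $ i) powr \<alpha> i)"
  proof (cases "x \<in> Rstar \<alpha>")
    case True
    then show ?thesis using nonneg unfolding monomial_weight_def
      by (auto simp: Rstar_def less_le intro!: prod.cong)
  next
    case False
    then obtain i where "\<alpha> i > 0" "x $ i \<le> 0" by (auto simp: Rstar_def not_less)
    then have "(\<Prod>i\<in>UNIV. if \<alpha> i = 0 then 1 else indicator {0<..} (x $ i) * (x $ i) powr \<alpha> i) = (0::real)"
      by (intro prod_zero bexI[of _ i]) auto
    then show ?thesis using False by simp
  qed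
  show ?thesis unfolding unnorm_density_def m e gweight_def by (simp add: prod.distrib)
qed

text \<open>The product formula for \<open>lborel\<close> is indexed by \<open>Basis\<close>; the
  bijection \<open>ax\<close> transports it to coordinate indices.\<close>

lemma nn_integral_lborel_vec_prod:
  fixes f :: "'n::finite \<Rightarrow> real \<Rightarrow> ennreal"
  assumes [measurable]: "\<And>i. f i \<in> borel_measurable borel"
  shows "(\<integral>\<^sup>+x. (\<Prod>i\<in>UNIV. f i ((x::real^'n) $ i)) \<partial>lborel) = (\<Prod>i\<in>UNIV. \<integral>\<^sup>+t. f i t \<partial>lborel)"
proof -
  define ax where "ax i = (axis i 1 :: real^'n)" for i
  have inj: "inj ax" by (auto simp: ax_def inj_on_def axis_eq_axis)
  have B: "(Basis :: (real^'n) set) = range ax" by (auto simp: Basis_vec_def ax_def)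
  have inner: "x \<bullet> ax i = x $ i" for x i by (simp add: ax_def inner_axis)
  have "(\<integral>\<^sup>+x. (\<Prod>b\<in>Basis. f (inv ax b) ((x::real^'n) \<bullet> b)) \<partial>lborel) = (\<Prod>b\<in>(Basis::(real^'n) set). \<integral>\<^sup>+t. f (inv ax b) t \<partial>lborel)"
    by (rule nn_integral_lborel_prod) auto
  then show ?thesis
    unfolding B by (simp add: prod.reindex[OF inj] inner inv_f_f[OF inj])
qed

text \<open>Computed through the nonnegative integral, where the product formula carries no
  integrability conditions.\<close>

lemma norm_const_eq_prod:
  assumes nonneg: "\<And>i. \<alpha> i \<ge> 0"
  shows "norm_const \<alpha> = (\<Prod>i\<in>UNIV. \<integral>t. gweight (\<alpha> i) t \<partial>lborel)"
proof -
  have ui: "unnorm_density \<alpha> = (\<lambda>x. \<Prod>i\<in>UNIV. gweight (\<alpha> i) (x $ i))"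
    using unnorm_density_eq_prod[where \<alpha>=\<alpha>, OF nonneg] by auto
  have "norm_const \<alpha> = enn2real (\<integral>\<^sup>+x. ennreal (\<Prod>i\<in>UNIV. gweight (\<alpha> i) (x $ i)) \<partial>lborel)"
    unfolding norm_const_def ui by (rule integral_eq_nn_integral) (auto intro!: prod_nonneg)
  also have "(\<integral>\<^sup>+x. ennreal (\<Prod>i\<in>UNIV. gweight (\<alpha> i) (x $ i)) \<partial>lborel) = (\<Prod>i\<in>UNIV. \<integral>\<^sup>+t. ennreal (gweight (\<alpha> i) t) \<partial>lborel)"
    by (subst nn_integral_lborel_vec_prod[symmetric]) (auto simp: prod_ennreal)
  also have "\<dots> = (\<Prod>i\<in>UNIV. ennreal (\<integral>t. gweight (\<alpha> i) t \<partial>lborel))"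
    using integrable_gweight[OF nonneg] by (intro prod.cong refl nn_integral_eq_integral) auto
  also have "\<dots> = ennreal (\<Prod>i\<in>UNIV. \<integral>t. gweight (\<alpha> i) t \<partial>lborel)"
    by (rule prod_ennreal) simp
  finally show ?thesis by (simp add: prod_nonneg)
qed

lemma sets_mu_A[simp, measurable_cong]: "sets (mu_A \<alpha>) = sets borel"
  by (simp add: mu_A_def)

lemma space_mu_A[simp]: "space (mu_A \<alpha>) = UNIV"
  by (simp add: mu_A_def)

lemma measurable_vec_nth_PiM: "vec_nth \<in> measurable borel (PiM UNIV (\<lambda>i::'n::finite. gmeasure (\<alpha> i)))"
proof -
  have "(\<lambda>x::real^'n. \<lambda>i\<in>UNIV. x $ i) \<in> measurable borel (PiM UNIV (\<lambda>i. gmeasure (\<alpha> i)))"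
    by (rule measurable_restrict) measurable
  then show ?thesis unfolding restrict_UNIV .
qed

lemma measurable_vec_lambda_PiM: "vec_lambda \<in> measurable (PiM UNIV (\<lambda>i::'n::finite. gmeasure (\<alpha> i))) borel"
proof -
  have "(\<lambda>x::'n \<Rightarrow> real. x i) \<in> borel_measurable (PiM UNIV (\<lambda>i. gmeasure (\<alpha> i)))" for i
    using measurable_component_singleton[of i UNIV "\<lambda>i. gmeasure (\<alpha> i)"] by (simp cong: measurable_cong_sets)
  then show ?thesis
    by (subst borel_measurable_euclidean_space) (auto simp: Basis_vec_def inner_axis)
qed

text \<open>A finite product of probability measures is determined by its values on boxes, and on a
  box both the density and \<open>norm_const\<close> split into coordinate factors.\<close>

lemma distr_mu_A:
  fixes \<alpha> :: "'n::finite \<Rightarrow> real"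
  assumes nonneg: "\<And>i. \<alpha> i \<ge> 0"
  shows "distr (mu_A \<alpha>) (PiM UNIV (\<lambda>i. gmeasure (\<alpha> i))) vec_nth = PiM UNIV (\<lambda>i. gmeasure (\<alpha> i))"
proof -
  let ?N = "\<lambda>i. gmeasure (\<alpha> i)"
  define Z where "Z i = (\<integral>t. gweight (\<alpha> i) t \<partial>lborel)" for i
  have Zpos: "Z i > 0" for i unfolding Z_def by (rule gweight_integral_pos[OF nonneg])
  interpret N: prob_space "?N i" for i by (rule prob_space_gmeasure[OF nonneg])
  interpret product_sigma_finite ?N ..
  show ?thesis
  proof (rule PiM_eqI)
    fix A assume "\<And>i. i \<in> UNIV \<Longrightarrow> A i \<in> sets (gmeasure (\<alpha> i))"
    then have A[measurable]: "A i \<in> sets borel" for i by simp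
    have dens: "ennreal (unnorm_density \<alpha> x / norm_const \<alpha>) = (\<Prod>i\<in>UNIV. ennreal (gweight (\<alpha> i) (x $ i) / Z i))" for x
    proof -
      have "unnorm_density \<alpha> x / norm_const \<alpha> = (\<Prod>i\<in>UNIV. gweight (\<alpha> i) (x $ i) / Z i)"
        unfolding unnorm_density_eq_prod[where \<alpha>=\<alpha>, OF nonneg] norm_const_eq_prod[where \<alpha>=\<alpha>, OF nonneg] Z_def prod_dividef ..
      then show ?thesis using Zpos by (simp add: prod_ennreal less_imp_le)
    qed
    have "emeasure (distr (mu_A \<alpha>) (PiM UNIV ?N) vec_nth) (Pi\<^sub>E UNIV A) = emeasure (mu_A \<alpha>) {x. \<forall>i. x $ i \<in> A i}"
    proof -
      have "vec_nth \<in> measurable (mu_A \<alpha>) (PiM UNIV ?N)"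
        using measurable_vec_nth_PiM[of \<alpha>] by (simp cong: measurable_cong_sets)
      moreover have "Pi\<^sub>E UNIV A \<in> sets (PiM UNIV ?N)" by (rule sets_PiM_I_finite) auto
      moreover have "vec_nth -` Pi\<^sub>E UNIV A \<inter> space (mu_A \<alpha>) = {x. \<forall>i. x $ i \<in> A i}" by auto
      ultimately show ?thesis by (simp add: emeasure_distr)
    qed
    also have "\<dots> = (\<integral>\<^sup>+x. (\<Prod>i\<in>UNIV. ennreal (gweight (\<alpha> i) (x $ i) / Z i)) * indicator {x. \<forall>i. x $ i \<in> A i} x \<partial>lborel)"
      unfolding mu_A_def dens by (subst emeasure_density) auto
    also have "\<dots> = (\<integral>\<^sup>+x. (\<Prod>i\<in>UNIV. ennreal (gweight (\<alpha> i) ((x::real^'n) $ i) / Z i) * indicator (A i) (x $ i)) \<partial>lborel)"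
    proof (rule nn_integral_cong)
      fix x :: "real^'n"
      have "indicator {x. \<forall>i. x $ i \<in> A i} x = (\<Prod>i\<in>UNIV. indicator (A i) (x $ i) :: ennreal)"
        by (cases "\<forall>i. x $ i \<in> A i") (auto simp: indicator_def)
      then show "(\<Prod>i\<in>UNIV. ennreal (gweight (\<alpha> i) (x $ i) / Z i)) * indicator {x. \<forall>i. x $ i \<in> A i} x =
        (\<Prod>i\<in>UNIV. ennreal (gweight (\<alpha> i) (x $ i) / Z i) * indicator (A i) (x $ i))"
        by (simp add: prod.distrib)
    qed
    also have "\<dots> = (\<Prod>i\<in>UNIV. emeasure (?N i) (A i))"
      unfolding gmeasure_def Z_def[symmetric] by (subst nn_integral_lborel_vec_prod) (auto simp: emeasure_density)
    finally show "emeasure (distr (mu_A \<alpha>) (PiM UNIV ?N) vec_nth) (Pi\<^sub>E UNIV A) = (\<Prod>i\<in>UNIV. emeasure (?N i) (A i))" .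
  qed auto
qed

text \<open>The form in which integrals are transferred: tensorization lives on functions
  \<open>'n \<Rightarrow> real\<close>, and \<open>vec_lambda\<close> undoes
  \<open>vec_nth\<close>.\<close>

lemma mu_A_eq_distr:
  fixes \<alpha> :: "'n::finite \<Rightarrow> real"
  assumes nonneg: "\<And>i. \<alpha> i \<ge> 0"
  shows "mu_A \<alpha> = distr (PiM UNIV (\<lambda>i. gmeasure (\<alpha> i))) borel vec_lambda"
proof -
  have "distr (PiM UNIV (\<lambda>i. gmeasure (\<alpha> i))) borel vec_lambda =
      distr (distr (mu_A \<alpha>) (PiM UNIV (\<lambda>i. gmeasure (\<alpha> i))) vec_nth) borel vec_lambda"
    by (simp add: distr_mu_A[where \<alpha>=\<alpha>, OF nonneg])
  also have "\<dots> = distr (mu_A \<alpha>) borel (vec_lambda \<circ> vec_nth)"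
    using measurable_vec_nth_PiM[of \<alpha>] measurable_vec_lambda_PiM[of \<alpha>]
    by (intro distr_distr) (auto cong: measurable_cong_sets)
  also have "\<dots> = distr (mu_A \<alpha>) (mu_A \<alpha>) (\<lambda>x. x)"
    by (intro distr_cong) auto
  finally show ?thesis by (simp add: distr_id)
qed

lemma prob_space_mu_A:
  assumes "\<And>i. \<alpha> i \<ge> 0"
  shows "prob_space (mu_A \<alpha>)"
  unfolding mu_A_eq_distr[where \<alpha>=\<alpha>, OF assms] using assms
  by (intro prob_space.prob_space_distr prob_space_PiM prob_space_gmeasure measurable_vec_lambda_PiM)

lemma integral_mu_A:
  fixes F :: "real^'n::finite \<Rightarrow> real"
  assumes "\<And>i. \<alpha> i \<ge> 0" and F: "F \<in> borel_measurable borel"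
  shows "(\<integral>x. F x \<partial>mu_A \<alpha>) = (\<integral>x. F (vec_lambda x) \<partial>PiM UNIV (\<lambda>i. gmeasure (\<alpha> i)))"
  unfolding mu_A_eq_distr[where \<alpha>=\<alpha>, OF assms(1)]
  by (rule integral_distr[OF measurable_vec_lambda_PiM F])

section \<open>Test functions: boundedness and the inequality on \<open>N_star\<close>\<close>

lemma bounded_compact_support:
  fixes f :: "'a::real_normed_vector \<Rightarrow> real"
  assumes "compact (closure {x. u x \<noteq> 0})" "continuous_on UNIV f"
    and "\<And>x. x \<notin> closure {x. u x \<noteq> (0::real)} \<Longrightarrow> f x = 0"
  obtains B where "\<And>x. \<bar>f x\<bar> \<le> B"
proof -
  have "compact (f ` closure {x. u x \<noteq> 0})"
    using assms by (intro compact_continuous_image continuous_on_subset[OF assms(2)]) auto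
  then obtain B where B: "\<forall>x\<in>closure {x. u x \<noteq> 0}. \<bar>f x\<bar> \<le> B"
    by (auto dest!: compact_imp_bounded simp: bounded_iff)
  have "\<bar>f x\<bar> \<le> max B 0" for x
    using B assms(3)[of x] by (cases "x \<in> closure {x. u x \<noteq> 0}") (auto intro: max.coboundedI1)
  then show ?thesis using that by blast
qed

lemma smooth_differentiable: "smooth u \<Longrightarrow> u differentiable (at x)"
  unfolding smooth_def by (metis foldr_Nil id_apply)

lemma smooth_pderiv_differentiable: "smooth u \<Longrightarrow> pderiv_i i u differentiable (at x)"
  unfolding smooth_def by (drule spec[of _ "[i]"]) simp

lemma differentiable_imp_continuous_on_UNIV:
  "(\<And>x. f differentiable (at x)) \<Longrightarrow> continuous_on UNIV f"
  by (simp add: continuous_at_imp_continuous_on differentiable_imp_continuous_within)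

text \<open>Near a point outside its closed support a test function vanishes identically, hence its
  derivative is 0 there; continuity on the compact support then bounds both.\<close>

lemma N_star_bounded:
  assumes "u \<in> N_star \<alpha>"
  shows "\<exists>B. \<forall>x. \<bar>u x\<bar> \<le> B" "\<exists>B. \<forall>x. \<bar>pderiv_i i u x\<bar> \<le> B"
    "continuous_on UNIV u" "continuous_on UNIV (pderiv_i i u)"
proof -
  have sm: "smooth u" and c: "compact (closure {x. u x \<noteq> 0})" using assms by (auto simp: N_star_def)
  show cu: "continuous_on UNIV u" "continuous_on UNIV (pderiv_i i u)"
    using smooth_differentiable[OF sm] smooth_pderiv_differentiable[OF sm]
    by (auto intro: differentiable_imp_continuous_on_UNIV)
  have z: "u x = 0" if "x \<notin> closure {x. u x \<noteq> 0}" for x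
    using that closure_subset[of "{x. u x \<noteq> 0}"] by blast
  show "\<exists>B. \<forall>x. \<bar>u x\<bar> \<le> B"
    using bounded_compact_support[OF c cu(1) z] by metis
  have "pderiv_i i u x = 0" if "x \<notin> closure {x. u x \<noteq> 0}" for x
  proof -
    have "(u has_derivative (\<lambda>_. 0)) (at x)"
    proof (rule has_derivative_transform_within_open[of "\<lambda>_. 0"])
      show "open (- closure {x. u x \<noteq> 0})" "x \<in> - closure {x. u x \<noteq> 0}" using that by auto
      show "\<And>y. y \<in> - closure {x. u x \<noteq> 0} \<Longrightarrow> 0 = u y" by (rule z[symmetric]) simp
    qed simp
    then show ?thesis by (simp add: pderiv_i_def frechet_derivative_at[symmetric])
  qed
  then show "\<exists>B. \<forall>x. \<bar>pderiv_i i u x\<bar> \<le> B"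
    using bounded_compact_support[OF c cu(2)] by metis
qed

lemma partial_derivative_line:
  fixes u :: "real^'n::finite \<Rightarrow> real"
  assumes "\<And>x. u differentiable (at x)"
  shows "((\<lambda>t. u (vec_lambda (x(i := t)))) has_real_derivative pderiv_i i u (vec_lambda (x(i := t)))) (at t)"
proof -
  define y where "y = vec_lambda (x(i := 0))"
  have eq: "vec_lambda (x(i := t)) = y + t *\<^sub>R axis i 1" for t
    by (auto simp: y_def vec_eq_iff axis_def)
  have 1: "((\<lambda>t. vec_lambda (x(i := t))) has_derivative (\<lambda>h. h *\<^sub>R axis i 1)) (at t)"
    unfolding eq by (auto intro!: derivative_eq_intros)
  have 2: "(u has_derivative frechet_derivative u (at (vec_lambda (x(i := t))))) (at (vec_lambda (x(i := t))))"
    using assms by (simp add: frechet_derivative_works)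
  interpret bounded_linear "frechet_derivative u (at (vec_lambda (x(i := t))))"
    using 2 by (rule has_derivative_bounded_linear)
  have "((\<lambda>t. u (vec_lambda (x(i := t)))) has_derivative (\<lambda>h. frechet_derivative u (at (vec_lambda (x(i := t)))) (h *\<^sub>R axis i 1))) (at t)"
    by (rule has_derivative_compose[OF 1 2])
  then show ?thesis
    by (simp add: has_field_derivative_def pderiv_i_def scaleR mult_commute_abs)
qed

lemma norm_grad_square: "(norm (grad u x))\<^sup>2 = (\<Sum>i\<in>UNIV. (pderiv_i i u x)\<^sup>2)"
  by (simp add: norm_vec_square grad_def)

text \<open>The energies for the tensorization are the squares of the partial derivatives. Freezing
  all coordinates but one turns \<open>u\<close> into a bounded function on the whole line with
  bounded continuous derivative, as the one-dimensional inequality requires.\<close>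

lemma poincare_N_star:
  fixes \<alpha> :: "'n::finite \<Rightarrow> real"
  assumes nonneg: "\<And>i. \<alpha> i \<ge> 0" and u: "u \<in> N_star \<alpha>"
  shows "(\<integral>x. (u x - (\<integral>y. u y \<partial>mu_A \<alpha>))\<^sup>2 \<partial>mu_A \<alpha>) \<le> (\<integral>x. (norm (grad u x))\<^sup>2 \<partial>mu_A \<alpha>)"
proof -
  note c = N_star_bounded(3,4)[OF u]
  have [measurable]: "u \<in> borel_measurable borel" "\<And>i. pderiv_i i u \<in> borel_measurable borel"
    using c by (auto intro: borel_measurable_continuous_onI)
  note [measurable] = measurable_vec_lambda_PiM[of \<alpha>]
  obtain B where B: "\<And>x. \<bar>u x\<bar> \<le> B" using N_star_bounded(1)[OF u] by auto
  obtain B' where B': "\<And>i x. \<bar>pderiv_i i u x\<bar> \<le> B' i" using N_star_bounded(2)[OF u] by metis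
  \<comment> \<open>\<open>tensorization\<close> takes a single bound for all \<open>i\<close>; the
    sum of the separate bounds provides it.\<close>
  define B2 where "B2 = (\<Sum>i\<in>UNIV. B' i)"
  have B'0: "0 \<le> B' i" for i using B'[of i undefined] by linarith
  have B2: "\<bar>pderiv_i i u x\<bar> \<le> B2" for i x
    using B'[of i x] member_le_sum[of i UNIV B'] B'0 by (fastforce simp: B2_def)
  have B2sq: "\<bar>(pderiv_i i u x)\<^sup>2\<bar> \<le> B2\<^sup>2" for i x
    using B2[of i x] B'0 by (simp add: abs_le_square_iff[symmetric] B2_def sum_nonneg)
  interpret prob_space "mu_A \<alpha>" by (rule prob_space_mu_A[where \<alpha>=\<alpha>, OF nonneg])
  let ?P = "PiM UNIV (\<lambda>i. gmeasure (\<alpha> i))"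
  have dif: "\<And>x. u differentiable (at x)" using u by (auto simp: N_star_def intro: smooth_differentiable)
  have vup: "continuous_on UNIV (\<lambda>t. vec_lambda (x(i := t)) :: real^'n)" for x i
  proof (rule continuous_on_vec_lambda)
    show "continuous_on UNIV (\<lambda>t. (x(i := t)) k)" for k by (cases "k = i") auto
  qed
  have "(\<integral>x. (u x - (\<integral>y. u y \<partial>mu_A \<alpha>))\<^sup>2 \<partial>mu_A \<alpha>) =
      (\<integral>x. (u (vec_lambda x) - (\<integral>y. u (vec_lambda y) \<partial>?P))\<^sup>2 \<partial>?P)"
    by (simp add: integral_mu_A[where \<alpha>=\<alpha>, OF nonneg])
  also have "\<dots> \<le> (\<Sum>i\<in>UNIV. \<integral>x. (pderiv_i i u (vec_lambda x))\<^sup>2 \<partial>?P)"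
  proof (rule tensorization)
    fix i and x :: "'n \<Rightarrow> real"
    show "(\<integral>t. (u (vec_lambda (x(i := t))) - (\<integral>s. u (vec_lambda (x(i := s))) \<partial>gmeasure (\<alpha> i)))\<^sup>2 \<partial>gmeasure (\<alpha> i))
       \<le> (\<integral>t. (pderiv_i i u (vec_lambda (x(i := t))))\<^sup>2 \<partial>gmeasure (\<alpha> i))"
    proof (rule poincare_gmeasure[OF nonneg partial_derivative_line[OF dif]])
      show "continuous_on UNIV (\<lambda>t. pderiv_i i u (vec_lambda (x(i := t))))"
        by (rule continuous_on_compose2[OF c(2) vup]) auto
    qed (rule B B2)+
  qed (use prob_space_gmeasure[OF nonneg] B B2sq in auto)
  also have "\<dots> = (\<Sum>i\<in>UNIV. \<integral>x. (pderiv_i i u x)\<^sup>2 \<partial>mu_A \<alpha>)"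
    by (simp add: integral_mu_A[where \<alpha>=\<alpha>, OF nonneg])
  also have "\<dots> = (\<integral>x. (\<Sum>i\<in>UNIV. (pderiv_i i u x)\<^sup>2) \<partial>mu_A \<alpha>)"
    by (rule Bochner_Integration.integral_sum[symmetric]) (rule integrable_bounded[of _ "B2\<^sup>2"], use B2sq in auto)
  finally show ?thesis by (simp add: norm_grad_square)
qed

section \<open>Passage to the completion\<close>

text \<open>Young's inequality for the cross term, from expanding the square of
  \<open>sqrt e *\<^sub>R a - (1 / sqrt e) *\<^sub>R b\<close>. The factor \<open>1 + e\<close> on
  the main term is what allows a limit without loss in the constant.\<close>

lemma norm_add_square_le:
  fixes a b :: "'a::real_inner"
  assumes "e > 0"
  shows "(norm (a + b))\<^sup>2 \<le> (1 + e) * (norm a)\<^sup>2 + (1 + 1 / e) * (norm b)\<^sup>2"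
proof -
  have "0 \<le> (norm (sqrt e *\<^sub>R a - (1 / sqrt e) *\<^sub>R b))\<^sup>2" by simp
  also have "\<dots> = e * (norm a)\<^sup>2 + (1 / e) * (norm b)\<^sup>2 - 2 * (a \<bullet> b)"
    using assms by (simp add: power2_norm_eq_inner inner_diff_left inner_diff_right inner_commute field_simps)
  finally have "2 * (a \<bullet> b) \<le> e * (norm a)\<^sup>2 + (1 / e) * (norm b)\<^sup>2" by simp
  moreover have "(norm (a + b))\<^sup>2 = (norm a)\<^sup>2 + 2 * (a \<bullet> b) + (norm b)\<^sup>2"
    by (simp add: power2_norm_eq_inner inner_add_left inner_add_right inner_commute)
  ultimately show ?thesis by (simp add: algebra_simps)
qed

lemma tendsto_integral_of_nn_integral:
  fixes f :: "nat \<Rightarrow> 'a \<Rightarrow> real"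
  assumes "\<And>k. integrable M (f k)" "\<And>k x. 0 \<le> f k x"
    and "(\<lambda>k. \<integral>\<^sup>+x. ennreal (f k x) \<partial>M) \<longlonglongrightarrow> 0"
  shows "(\<lambda>k. \<integral>x. f k x \<partial>M) \<longlonglongrightarrow> 0"
proof -
  have "(\<integral>\<^sup>+x. ennreal (f k x) \<partial>M) = ennreal (\<integral>x. f k x \<partial>M)" for k
    using assms(1,2) by (intro nn_integral_eq_integral) auto
  then have "(\<lambda>k. ennreal (\<integral>x. f k x \<partial>M)) \<longlonglongrightarrow> ennreal 0" using assms(3) by simp
  then show ?thesis
    by (subst (asm) tendsto_ennreal_iff) (auto intro!: always_eventually integral_nonneg_AE assms(2))
qed

lemma (in prob_space) poincare_closure:
  fixes u :: "'a \<Rightarrow> real" and g :: "'a \<Rightarrow> 'b::{real_inner, second_countable_topology}"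
  assumes [measurable]: "u \<in> borel_measurable M" "g \<in> borel_measurable M"
    "\<And>k. uk k \<in> borel_measurable M" "\<And>k. gk k \<in> borel_measurable M"
    and iu: "(\<integral>\<^sup>+x. ennreal ((u x)\<^sup>2) \<partial>M) < \<infinity>" and ig: "(\<integral>\<^sup>+x. ennreal ((norm (g x))\<^sup>2) \<partial>M) < \<infinity>"
    and iuk: "\<And>k. integrable M (\<lambda>x. (uk k x)\<^sup>2)" and igk: "\<And>k. integrable M (\<lambda>x. (norm (gk k x))\<^sup>2)"
    and poincare: "\<And>k. (\<integral>x. (uk k x - (\<integral>y. uk k y \<partial>M))\<^sup>2 \<partial>M) \<le> (\<integral>x. (norm (gk k x))\<^sup>2 \<partial>M)"
    and lim_u: "(\<lambda>k. \<integral>\<^sup>+x. ennreal ((uk k x - u x)\<^sup>2) \<partial>M) \<longlonglongrightarrow> 0"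
    and lim_g: "(\<lambda>k. \<integral>\<^sup>+x. ennreal ((norm (gk k x - g x))\<^sup>2) \<partial>M) \<longlonglongrightarrow> 0"
  shows "(\<integral>x. (u x - (\<integral>y. u y \<partial>M))\<^sup>2 \<partial>M) \<le> (\<integral>x. (norm (g x))\<^sup>2 \<partial>M)"
proof -
  have u2: "integrable M (\<lambda>x. (u x)\<^sup>2)" by (rule integrableI_nonneg) (use iu in auto)
  have g2: "integrable M (\<lambda>x. (norm (g x))\<^sup>2)" by (rule integrableI_nonneg) (use ig in auto)
  have u1: "integrable M u" by (rule square_integrable_imp_integrable) (use u2 in auto)
  have uk1: "integrable M (uk k)" for k by (rule square_integrable_imp_integrable) (use iuk in auto)
  have du: "integrable M (\<lambda>x. (uk k x - u x)\<^sup>2)" for k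
  proof (rule Bochner_Integration.integrable_bound)
    show "integrable M (\<lambda>x. 2 * (uk k x)\<^sup>2 + 2 * (u x)\<^sup>2)" using iuk u2 by simp
    show "AE x in M. norm ((uk k x - u x)\<^sup>2) \<le> norm (2 * (uk k x)\<^sup>2 + 2 * (u x)\<^sup>2)"
      using norm_add_square_le[of 1 "uk k _" "- u _"] by simp
  qed measurable
  have dg: "integrable M (\<lambda>x. (norm (gk k x - g x))\<^sup>2)" for k
  proof (rule Bochner_Integration.integrable_bound)
    show "integrable M (\<lambda>x. 2 * (norm (gk k x))\<^sup>2 + 2 * (norm (g x))\<^sup>2)" using igk g2 by simp
    show "AE x in M. norm ((norm (gk k x - g x))\<^sup>2) \<le> norm (2 * (norm (gk k x))\<^sup>2 + 2 * (norm (g x))\<^sup>2)"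
      using norm_add_square_le[of 1 "gk k _" "- g _"] by simp
  qed measurable
  define a where "a k = (\<integral>x. (uk k x - u x)\<^sup>2 \<partial>M)" for k
  define b where "b k = (\<integral>x. (norm (gk k x - g x))\<^sup>2 \<partial>M)" for k
  define G where "G = (\<integral>x. (norm (g x))\<^sup>2 \<partial>M)"
  define V where "V = (\<integral>x. (u x - (\<integral>y. u y \<partial>M))\<^sup>2 \<partial>M)"
  have a: "a \<longlonglongrightarrow> 0" unfolding a_def using du lim_u by (intro tendsto_integral_of_nn_integral) auto
  have b: "b \<longlonglongrightarrow> 0" unfolding b_def using dg lim_g by (intro tendsto_integral_of_nn_integral) auto
  have main: "V \<le> (1 + e) * ((1 + e) * G + (1 + 1 / e) * b k) + (1 + 1 / e) * a k" if e: "e > 0" for e k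
  proof -
    define c where "c = (\<integral>y. uk k y \<partial>M)"
    have exp: "(f x - c)\<^sup>2 = (f x)\<^sup>2 - 2 * c * f x + c\<^sup>2" for f x
      by (simp add: power2_eq_square algebra_simps)
    have i1: "integrable M (\<lambda>x. (u x - c)\<^sup>2)" "integrable M (\<lambda>x. (uk k x - c)\<^sup>2)"
      unfolding exp using u1 u2 uk1 iuk by simp_all
    \<comment> \<open>The mean is the best centre, so the mean of \<open>uk k\<close> may replace
      that of \<open>u\<close>; this avoids a separate argument for the convergence of the
      means.\<close>
    have "V \<le> (\<integral>x. (u x - c)\<^sup>2 \<partial>M)"
      using integral_square_shift[OF u1 u2, of c] by (simp add: V_def)
    also have "\<dots> \<le> (\<integral>x. (1 + e) * (uk k x - c)\<^sup>2 + (1 + 1 / e) * (uk k x - u x)\<^sup>2 \<partial>M)"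
    proof (rule integral_mono)
      show "(u x - c)\<^sup>2 \<le> (1 + e) * (uk k x - c)\<^sup>2 + (1 + 1 / e) * (uk k x - u x)\<^sup>2" for x
        using norm_add_square_le[OF e, of "uk k x - c" "u x - uk k x"] by (simp add: power2_commute)
    qed (use i1 du in simp_all)
    also have "\<dots> = (1 + e) * (\<integral>x. (uk k x - c)\<^sup>2 \<partial>M) + (1 + 1 / e) * a k"
      using i1 du by (simp add: a_def)
    also have "(\<integral>x. (uk k x - c)\<^sup>2 \<partial>M) \<le> (\<integral>x. (norm (gk k x))\<^sup>2 \<partial>M)"
      unfolding c_def by (rule poincare)
    also have "\<dots> \<le> (\<integral>x. (1 + e) * (norm (g x))\<^sup>2 + (1 + 1 / e) * (norm (gk k x - g x))\<^sup>2 \<partial>M)"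
    proof (rule integral_mono)
      show "(norm (gk k x))\<^sup>2 \<le> (1 + e) * (norm (g x))\<^sup>2 + (1 + 1 / e) * (norm (gk k x - g x))\<^sup>2" for x
        using norm_add_square_le[OF e, of "g x" "gk k x - g x"] by simp
    qed (use igk g2 dg in simp_all)
    also have "\<dots> = (1 + e) * G + (1 + 1 / e) * b k"
      using g2 dg by (simp add: b_def G_def)
    finally show ?thesis using e by simp
  qed
  \<comment> \<open>The order of the limits matters: \<open>k\<close> tends to infinity with
    \<open>e\<close> fixed, because \<open>1 + 1 / e\<close> blows up as \<open>e\<close> tends to
    0.\<close>
  have "V \<le> (1 + e) * ((1 + e) * G)" if e: "e > 0" for e
  proof (rule LIMSEQ_le_const)
    show "(\<lambda>k. (1 + e) * ((1 + e) * G + (1 + 1 / e) * b k) + (1 + 1 / e) * a k) \<longlonglongrightarrow> (1 + e) * ((1 + e) * G)"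
      using a b by (auto intro!: tendsto_eq_intros)
  qed (use main[OF e] in auto)
  moreover have "((\<lambda>e. (1 + e) * ((1 + e) * G)) \<longlongrightarrow> (1 + 0) * ((1 + 0) * G)) (at_right 0)"
    by (intro tendsto_intros)
  ultimately have "V \<le> (1 + 0) * ((1 + 0) * G)"
    by (intro tendsto_lowerbound[of _ _ "at_right 0"]) (auto simp: eventually_at_right_less eventually_at_filter)
  then show ?thesis by (simp add: V_def G_def)
qed

lemma grad_measurable:
  assumes "u \<in> N_star \<alpha>"
  shows "grad u \<in> borel_measurable borel"
proof -
  have "continuous_on UNIV (grad u)" unfolding grad_def[abs_def]
    using N_star_bounded(4)[OF assms] by (intro continuous_on_vec_lambda)
  then show ?thesis by (rule borel_measurable_continuous_onI)
qed

lemma poincare_X_A: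
  fixes \<alpha> :: "'n::finite \<Rightarrow> real"
  assumes nonneg: "\<And>i. \<alpha> i \<ge> 0" and "(u, g) \<in> X_A \<alpha>"
  shows "(\<integral>x. (u x - (\<integral>y. u y \<partial>mu_A \<alpha>))\<^sup>2 \<partial>mu_A \<alpha>) \<le> (\<integral>x. (norm (g x))\<^sup>2 \<partial>mu_A \<alpha>)"
proof -
  interpret prob_space "mu_A \<alpha>" by (rule prob_space_mu_A[where \<alpha>=\<alpha>, OF nonneg])
  obtain uk where uk: "\<And>k. uk k \<in> N_star \<alpha>"
    and lim: "(\<lambda>k. \<integral>\<^sup>+ x. ennreal ((uk k x - u x)\<^sup>2) \<partial>mu_A \<alpha>) \<longlonglongrightarrow> 0"
      "(\<lambda>k. \<integral>\<^sup>+ x. ennreal ((norm (grad (uk k) x - g x))\<^sup>2) \<partial>mu_A \<alpha>) \<longlonglongrightarrow> 0"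
    and ug: "u \<in> borel_measurable (mu_A \<alpha>)" "g \<in> borel_measurable (mu_A \<alpha>)"
      "(\<integral>\<^sup>+ x. ennreal ((u x)\<^sup>2) \<partial>mu_A \<alpha>) < \<infinity>" "(\<integral>\<^sup>+ x. ennreal ((norm (g x))\<^sup>2) \<partial>mu_A \<alpha>) < \<infinity>"
    using assms(2) unfolding X_A_def by blast
  have sq: "\<bar>a\<^sup>2\<bar> \<le> B\<^sup>2" if "\<bar>a\<bar> \<le> B" for a B :: real
    using that by (simp add: abs_le_square_iff[symmetric])
  have m1: "uk k \<in> borel_measurable (mu_A \<alpha>)" for k
    using borel_measurable_continuous_onI[OF N_star_bounded(3)[OF uk]] by (simp cong: measurable_cong_sets)
  have m2: "pderiv_i i (uk k) \<in> borel_measurable (mu_A \<alpha>)" for i k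
    using borel_measurable_continuous_onI[OF N_star_bounded(4)[OF uk]] by (simp cong: measurable_cong_sets)
  have m3: "grad (uk k) \<in> borel_measurable (mu_A \<alpha>)" for k
    using grad_measurable[OF uk] by (simp cong: measurable_cong_sets)
  have i1: "integrable (mu_A \<alpha>) (\<lambda>x. (uk k x)\<^sup>2)" for k
  proof -
    obtain B where "\<And>x. \<bar>uk k x\<bar> \<le> B" using N_star_bounded(1)[OF uk] by blast
    then show ?thesis using m1 sq by (intro integrable_bounded[of _ "B\<^sup>2"]) auto
  qed
  have i2: "integrable (mu_A \<alpha>) (\<lambda>x. (norm (grad (uk k) x))\<^sup>2)" for k
    unfolding norm_grad_square
  proof (rule Bochner_Integration.integrable_sum)
    fix i
    obtain B where "\<And>x. \<bar>pderiv_i i (uk k) x\<bar> \<le> B" using N_star_bounded(2)[OF uk] by blast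
    then show "integrable (mu_A \<alpha>) (\<lambda>x. (pderiv_i i (uk k) x)\<^sup>2)"
      using m2 sq by (intro integrable_bounded[of _ "B\<^sup>2"]) auto
  qed
  show ?thesis
    by (rule poincare_closure[where uk=uk and gk="\<lambda>k. grad (uk k)", OF ug(1,2) m1 m3 ug(3,4) i1 i2 poincare_N_star[where \<alpha>=\<alpha>, OF nonneg uk] lim])
qed


section \<open>Smooth truncations of a coordinate\<close>

text \<open>The classical flat function \<open>exp (- (1 / t))\<close> together with the negative
  powers that differentiation produces. Derivatives stay in the linear span of the family, so no
  explicit formula for higher ones is required.\<close>

definition flat_exp :: "nat \<Rightarrow> real \<Rightarrow> real" where
  "flat_exp m t = (if 0 < t then exp (- (1 / t)) / t ^ m else 0)"

lemma flat_exp_nonneg: "0 \<le> flat_exp m t"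
  by (simp add: flat_exp_def)

lemma power_over_fact_le_exp:
  fixes x :: real
  assumes "0 \<le> x"
  shows "x ^ n / fact n \<le> exp x"
proof -
  have "(\<Sum>i\<in>{n}. inverse (fact i) * x ^ i) \<le> (\<Sum>i. inverse (fact i) * x ^ i)"
    using assms summable_exp[of x] by (intro sum_le_suminf) auto
  then show ?thesis by (simp add: exp_def divide_inverse mult.commute scaleR_conv_of_real)
qed

text \<open>A single term of the exponential series at \<open>1 / t\<close> beats the pole. Degree
  \<open>m + 2\<close> leaves the factor \<open>t\<^sup>2\<close> that sends the difference quotient
  at 0 to 0.\<close>

lemma flat_exp_le: "flat_exp m t \<le> fact (m + 2) * t\<^sup>2"
proof (cases "0 < t")
  case True
  have "(1 / t) ^ (m + 2) / fact (m + 2) \<le> exp (1 / t)"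
    using True by (intro power_over_fact_le_exp) auto
  then have "exp (- (1 / t)) \<le> fact (m + 2) * t ^ (m + 2)"
    using True by (simp add: exp_minus field_simps power_one_over del: fact_Suc)
  then show ?thesis using True by (simp add: flat_exp_def field_simps power_add power2_eq_square del: fact_Suc)
qed (simp add: flat_exp_def)

lemma flat_exp_has_derivative:
  "(flat_exp m has_real_derivative flat_exp (m + 2) t - real m * flat_exp (m + 1) t) (at t)"
proof -
  consider "t < 0" | "t = 0" | "t > 0" by linarith
  then show ?thesis
  proof cases
    case 1
    have "((\<lambda>_. 0) has_real_derivative 0) (at t)" by simp
    then have "(flat_exp m has_real_derivative 0) (at t)"
      by (rule has_field_derivative_transform_within_open[of _ _ _ "{..<0}"]) (use 1 in \<open>auto simp: flat_exp_def\<close>)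
    then show ?thesis using 1 by (simp add: flat_exp_def)
  next
    case 2
    have "((\<lambda>h. flat_exp m h / h) \<longlongrightarrow> 0) (at 0)"
    proof (rule Lim_null_comparison)
      show "((\<lambda>h. fact (m + 2) * \<bar>h\<bar>) \<longlongrightarrow> 0) (at (0::real))"
        by (auto intro!: tendsto_eq_intros)
      have "norm (flat_exp m h / h) \<le> fact (m + 2) * \<bar>h\<bar>" if "h \<noteq> 0" for h
        using flat_exp_le[of m h] flat_exp_nonneg[of m h] that
        by (simp add: abs_divide divide_le_eq power2_eq_square abs_mult mult.assoc del: fact_Suc)
      then show "\<forall>\<^sub>F h in at 0. norm (flat_exp m h / h) \<le> fact (m + 2) * \<bar>h\<bar>"
        by (simp add: eventually_at_filter del: fact_Suc)
    qed
    then show ?thesis using 2 by (simp add: has_field_derivative_iff flat_exp_def)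
  next
    case 3
    have "((\<lambda>t. exp (- (1 / t)) * (1 / t) ^ m) has_real_derivative flat_exp (m + 2) t - real m * flat_exp (m + 1) t) (at t)"
      using 3 by (cases m) (auto intro!: derivative_eq_intros simp: flat_exp_def field_simps power2_eq_square power_one_over,
        metis One_nat_def power_eq_if)
    then show ?thesis
      by (rule has_field_derivative_transform_within_open[of _ _ _ "{0<..}"]) (use 3 in \<open>auto simp: flat_exp_def power_one_over\<close>)
  qed
qed

lemma pderiv_iI:
  assumes "\<And>x. (f has_derivative F x) (at x)"
  shows "pderiv_i i f = (\<lambda>x. F x (axis i 1))"
  unfolding pderiv_i_def frechet_derivative_at[OF assms, symmetric] ..

text \<open>\<open>smooth\<close> asks for differentiability of all iterated partial derivatives.
  This class contains the truncations and is stable under \<open>pderiv_i\<close>, which turns the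
  demand into an induction over lists. Using the squared norm makes the radial argument polynomial,
  hence smooth at the origin.\<close>

inductive bump_class :: "(real^'n::finite \<Rightarrow> real) \<Rightarrow> bool" where
  const: "bump_class (\<lambda>x. c)"
| coord: "bump_class (\<lambda>x. x $ i)"
| flat: "bump_class (\<lambda>x. flat_exp m (1 - b * (norm x)\<^sup>2))"
| add: "bump_class f \<Longrightarrow> bump_class g \<Longrightarrow> bump_class (\<lambda>x. f x + g x)"
| mult: "bump_class f \<Longrightarrow> bump_class g \<Longrightarrow> bump_class (\<lambda>x. f x * g x)"

lemma flat_exp_norm_has_derivative:
  fixes x :: "real^'n::finite"
  shows "((\<lambda>x. flat_exp m (1 - b * (norm x)\<^sup>2)) has_derivative
    (\<lambda>h. (flat_exp (m + 2) (1 - b * (norm x)\<^sup>2) - real m * flat_exp (m + 1) (1 - b * (norm x)\<^sup>2)) * (- (2 * b) * (x \<bullet> h)))) (at x)"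
proof -
  have "((\<lambda>x. 1 - b * (norm x)\<^sup>2) has_derivative (\<lambda>h. - (2 * b) * (x \<bullet> h))) (at x)"
    unfolding power2_norm_eq_inner by (auto intro!: derivative_eq_intros simp: inner_commute)
  from has_derivative_compose[OF this flat_exp_has_derivative[unfolded has_field_derivative_def]]
  show ?thesis .
qed

lemma bump_class_derivative:
  assumes "bump_class f"
  shows "(\<forall>x. f differentiable (at x)) \<and> bump_class (pderiv_i j f)"
  using assms
proof induction
  case (const c)
  have "pderiv_i j (\<lambda>x::real^'a. c) = (\<lambda>x. 0)" by (rule pderiv_iI) simp
  then show ?case by (simp add: bump_class.const)
next
  case (coord i)
  have d: "((\<lambda>x::real^'a. x $ i) has_derivative (\<lambda>h. h $ i)) (at x)" for x
    by (intro bounded_linear_imp_has_derivative bounded_linear_vec_nth)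
  then show ?case using pderiv_iI[of "\<lambda>x::real^'a. x $ i", OF d, of j]
    by (auto simp: bump_class.const differentiable_def)
next
  case (flat m b)
  have "pderiv_i j (\<lambda>x. flat_exp m (1 - b * (norm x)\<^sup>2)) =
    (\<lambda>x. (flat_exp (m + 2) (1 - b * (norm x)\<^sup>2) + (- real m) * flat_exp (m + 1) (1 - b * (norm x)\<^sup>2)) * (- (2 * b) * x $ j))"
    by (subst pderiv_iI[OF flat_exp_norm_has_derivative]) (simp add: inner_axis)
  moreover have "bump_class \<dots>" by (intro bump_class.intros)
  ultimately show ?case using flat_exp_norm_has_derivative[of m b]
    by (auto simp: differentiable_def)
next
  case (add f g)
  then have d: "(f has_derivative frechet_derivative f (at x)) (at x)" "(g has_derivative frechet_derivative g (at x)) (at x)" for x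
    by (auto simp: frechet_derivative_works[symmetric])
  have "pderiv_i j (\<lambda>x. f x + g x) = (\<lambda>x. pderiv_i j f x + pderiv_i j g x)"
    by (subst pderiv_iI[OF has_derivative_add[OF d]]) (simp add: pderiv_i_def)
  then show ?case using add by (auto intro: bump_class.add)
next
  case (mult f g)
  then have d: "(f has_derivative frechet_derivative f (at x)) (at x)" "(g has_derivative frechet_derivative g (at x)) (at x)" for x
    by (auto simp: frechet_derivative_works[symmetric])
  have "pderiv_i j (\<lambda>x. f x * g x) = (\<lambda>x. f x * pderiv_i j g x + pderiv_i j f x * g x)"
    by (subst pderiv_iI[OF has_derivative_mult[OF d]]) (simp add: pderiv_i_def)
  then show ?case using mult by (auto intro: bump_class.add bump_class.mult)
qed

lemma bump_class_smooth:
  assumes "bump_class f"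
  shows "smooth f"
proof -
  have "bump_class (foldr pderiv_i is f)" for "is"
    using assms by (induction "is") (simp_all add: bump_class_derivative)
  then show ?thesis by (simp add: smooth_def bump_class_derivative)
qed

section \<open>Truncated coordinates and bounds uniform in the truncation\<close>

definition cutoff :: "nat \<Rightarrow> real" where
  "cutoff k = 1 / (real (Suc k))\<^sup>2"

lemma cutoff: "0 < cutoff k" "cutoff \<longlonglongrightarrow> 0"
proof -
  show "cutoff \<longlonglongrightarrow> 0"
    using tendsto_power[OF LIMSEQ_inverse_real_of_nat, of 2]
    by (simp add: cutoff_def[abs_def] power_inverse inverse_eq_divide power_one_over)
qed (simp add: cutoff_def)

text \<open>Radial cutoffs preserve the Neumann condition: the radial derivative of the cutoff factor
  contributes a multiple of \<open>x\<^sub>j\<close> to the \<open>j\<close>-th partial derivative.\<close>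
definition trunc :: "'n::finite \<Rightarrow> nat \<Rightarrow> real^'n \<Rightarrow> real" where
  "trunc i k x = x $ i * (exp 1 * flat_exp 0 (1 - cutoff k * (norm x)\<^sup>2))"

text \<open>Equality holds at \<open>s = 1\<close>: the factor \<open>exp 1\<close> in
  \<open>trunc\<close> is chosen to make the cutoffs tend to 1 as \<open>cutoff k\<close> tends to
  0.\<close>

lemma flat_exp_0_le: "s \<le> 1 \<Longrightarrow> exp 1 * flat_exp 0 s \<le> 1"
proof (cases "0 < s")
  case True
  assume "s \<le> 1"
  then have "1 - 1 / s \<le> 0" using True by (simp add: le_divide_eq)
  then have "exp (1 - 1 / s) \<le> 1" by simp
  then show ?thesis using True by (simp add: flat_exp_def exp_diff exp_minus divide_inverse)
qed (simp add: flat_exp_def)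

text \<open>The constant is \<open>fact 4\<close>, from the quadratic bound with
  \<open>m = 2\<close>.\<close>

lemma flat_exp_2_le: "s \<le> 1 \<Longrightarrow> flat_exp 2 s \<le> 24"
proof (cases "0 < s")
  case True
  assume "s \<le> 1"
  then have "s\<^sup>2 \<le> 1" using True by (simp add: power_le_one)
  then show ?thesis using flat_exp_le[of 2 s] by (simp add: eval_nat_numeral fact_numeral)
qed (simp add: flat_exp_def)

lemma pderiv_trunc:
  fixes x :: "real^'n::finite"
  shows "pderiv_i j (trunc i k) x = (if j = i then 1 else 0) * (exp 1 * flat_exp 0 (1 - cutoff k * (norm x)\<^sup>2)) -
    2 * exp 1 * flat_exp 2 (1 - cutoff k * (norm x)\<^sup>2) * (cutoff k * (x $ i * x $ j))"
proof -
  have d0: "((\<lambda>x. flat_exp 0 (1 - cutoff k * (norm x)\<^sup>2)) has_derivative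
     (\<lambda>h. flat_exp 2 (1 - cutoff k * (norm x)\<^sup>2) * (- (2 * cutoff k) * (x \<bullet> h)))) (at x)" for x :: "real^'n"
    using flat_exp_norm_has_derivative[of 0 "cutoff k" x] by (simp add: numeral_2_eq_2)
  have d: "((\<lambda>x. x $ i * (exp 1 * flat_exp 0 (1 - cutoff k * (norm x)\<^sup>2))) has_derivative
     (\<lambda>h. x $ i * (exp 1 * (flat_exp 2 (1 - cutoff k * (norm x)\<^sup>2) * (- (2 * cutoff k) * (x \<bullet> h))))
      + h $ i * (exp 1 * flat_exp 0 (1 - cutoff k * (norm x)\<^sup>2)))) (at x)" for x :: "real^'n"
    by (intro has_derivative_mult has_derivative_mult_right d0
        bounded_linear_imp_has_derivative bounded_linear_vec_nth)
  have ax: "(axis j 1 :: real^'n) $ i = (if j = i then 1 else 0)" by (simp add: axis_def)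
  show ?thesis
    unfolding trunc_def[abs_def] by (subst pderiv_iI[OF d]) (simp add: inner_axis ax algebra_simps)
qed

lemma trunc_in_N_star:
  assumes i: "\<alpha> i = 0"
  shows "trunc i k \<in> N_star \<alpha>"
proof -
  have "smooth (trunc i k)" unfolding trunc_def[abs_def]
    by (intro bump_class_smooth bump_class.intros)
  moreover have "compact (closure {x. trunc i k x \<noteq> 0})"
  proof (subst compact_closure, rule bounded_subset)
    show "bounded (cball 0 (real (Suc k)))" by simp
    show "{x. trunc i k x \<noteq> 0} \<subseteq> cball 0 (real (Suc k))"
    proof
      fix x assume "x \<in> {x. trunc i k x \<noteq> 0}"
      \<comment> \<open>The flat factor is nonzero only where its argument is positive, and
        \<open>cutoff k\<close> is the inverse square of the intended radius
        \<open>Suc k\<close>.\<close>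
      then have "cutoff k * (norm x)\<^sup>2 < 1" by (auto simp: trunc_def flat_exp_def split: if_splits)
      then have "(norm x)\<^sup>2 < (real (Suc k))\<^sup>2" by (simp add: cutoff_def divide_less_eq)
      then have "norm x \<le> real (Suc k)" by (rule power2_le_imp_le[OF less_imp_le]) simp
      then show "x \<in> cball 0 (real (Suc k))" by simp
    qed
  qed
  \<comment> \<open>Here \<open>\<alpha> i = 0\<close> is decisive: \<open>\<alpha> j > 0\<close>
    gives \<open>j \<noteq> i\<close>, so the derivative of the factor \<open>x $ i\<close>
    contributes nothing.\<close>
  moreover have "pderiv_i j (trunc i k) x = 0" if "\<alpha> j > 0" "x $ j = 0" for j x
    using i that by (auto simp: pderiv_trunc)
  ultimately show ?thesis by (auto simp: N_star_def)
qed

lemma trunc_tendsto: "(\<lambda>k. trunc i k x) \<longlonglongrightarrow> x $ i"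
  and pderiv_trunc_tendsto: "(\<lambda>k. pderiv_i j (trunc i k) x) \<longlonglongrightarrow> (if j = i then 1 else 0)"
proof -
  have "isCont (flat_exp m) 1" for m using DERIV_isCont flat_exp_has_derivative by blast
  then have s: "(\<lambda>k. flat_exp m (1 - cutoff k * (norm x)\<^sup>2)) \<longlonglongrightarrow> flat_exp m 1" for m
    by (rule isCont_tendsto_compose) (auto intro!: tendsto_eq_intros cutoff(2))
  have f1: "exp 1 * flat_exp 0 1 = 1" by (simp add: flat_exp_def exp_minus)
  have "(\<lambda>k. trunc i k x) \<longlonglongrightarrow> x $ i * (exp 1 * flat_exp 0 1)"
    unfolding trunc_def by (intro tendsto_intros s)
  then show "(\<lambda>k. trunc i k x) \<longlonglongrightarrow> x $ i" unfolding f1 by simp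
  have "(\<lambda>k. pderiv_i j (trunc i k) x) \<longlonglongrightarrow>
    (if j = i then 1 else 0) * (exp 1 * flat_exp 0 1) - 2 * exp 1 * flat_exp 2 1 * (0 * (x $ i * x $ j))"
    unfolding pderiv_trunc by (intro tendsto_intros s cutoff(2))
  then show "(\<lambda>k. pderiv_i j (trunc i k) x) \<longlonglongrightarrow> (if j = i then 1 else 0)"
    unfolding f1 by simp
qed

lemma one_minus_cutoff_le: "1 - cutoff k * (norm x)\<^sup>2 \<le> 1"
  using cutoff(1)[of k] by simp

text \<open>The cutoff factor lies between 0 and 1. The right side is free of \<open>k\<close> and
  serves as dominating function for the convergence in L2.\<close>

lemma trunc_error_le: "(trunc i k x - x $ i)\<^sup>2 \<le> (x $ i)\<^sup>2"
proof -
  define c where "c = exp 1 * flat_exp 0 (1 - cutoff k * (norm x)\<^sup>2)"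
  have c: "0 \<le> c" "c \<le> 1"
    using flat_exp_0_le[OF one_minus_cutoff_le] by (auto simp: c_def flat_exp_nonneg)
  have "\<bar>c - 1\<bar> \<le> 1" using c by auto
  then have "(c - 1)\<^sup>2 \<le> 1" by (simp add: abs_square_le_1)
  then have "(x $ i)\<^sup>2 * (c - 1)\<^sup>2 \<le> (x $ i)\<^sup>2 * 1" by (intro mult_left_mono) auto
  then show ?thesis by (simp add: trunc_def c_def[symmetric] power_mult_distrib[symmetric] algebra_simps)
qed

text \<open>Differentiating the cutoff brings \<open>cutoff k * (x $ i * x $ j)\<close>, and
  \<open>cutoff k * (norm x)\<^sup>2 \<le> 1\<close> wherever the flat factor is nonzero, so the
  bound is uniform in \<open>k\<close>; \<open>48\<close> is twice the bound on
  \<open>flat_exp 2\<close>.\<close>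

lemma pderiv_trunc_le: "\<bar>pderiv_i j (trunc i k) x\<bar> \<le> 1 + 48 * exp 1"
proof -
  let ?s = "1 - cutoff k * (norm x)\<^sup>2"
  have 1: "\<bar>(if j = i then 1 else 0) * (exp 1 * flat_exp 0 ?s)\<bar> \<le> 1"
    using flat_exp_0_le[OF one_minus_cutoff_le[of k x]] flat_exp_nonneg[of 0 ?s] by (simp add: abs_mult)
  have 2: "flat_exp 2 ?s * \<bar>cutoff k * (x $ i * x $ j)\<bar> \<le> 24 * 1"
  proof (cases "0 < ?s")
    case True
    have "\<bar>x $ i\<bar> * \<bar>x $ j\<bar> \<le> norm x * norm x"
      by (intro mult_mono component_le_norm_cart) auto
    then have "cutoff k * (\<bar>x $ i\<bar> * \<bar>x $ j\<bar>) \<le> cutoff k * (norm x)\<^sup>2"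
      using cutoff(1)[of k] by (simp add: power2_eq_square)
    also have "\<dots> \<le> 1" using True by simp
    finally have "\<bar>cutoff k * (x $ i * x $ j)\<bar> \<le> 1"
      using cutoff(1)[of k] by (simp add: abs_mult)
    then show ?thesis
      using flat_exp_2_le[OF one_minus_cutoff_le[of k x]] by (intro mult_mono) (auto simp: flat_exp_nonneg)
  next
    case False
    then have "flat_exp 2 ?s = 0" by (simp add: flat_exp_def)
    then show ?thesis by simp
  qed
  have "\<bar>2 * exp 1 * flat_exp 2 ?s * (cutoff k * (x $ i * x $ j))\<bar> = 2 * exp 1 * (flat_exp 2 ?s * \<bar>cutoff k * (x $ i * x $ j)\<bar>)"
    using flat_exp_nonneg[of 2 ?s] by (simp add: abs_mult)
  also have "\<dots> \<le> 2 * exp 1 * (24 * 1)" by (intro mult_left_mono 2) auto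
  finally have 3: "\<bar>2 * exp 1 * flat_exp 2 ?s * (cutoff k * (x $ i * x $ j))\<bar> \<le> 48 * exp 1" by simp
  show ?thesis unfolding pderiv_trunc using 1 3 by linarith
qed


section \<open>The Gaussian coordinate\<close>

lemma distr_mu_A_component:
  fixes \<alpha> :: "'n::finite \<Rightarrow> real"
  assumes nonneg: "\<And>i. \<alpha> i \<ge> 0"
  shows "distr (mu_A \<alpha>) borel (\<lambda>x. x $ i) = gmeasure (\<alpha> i)"
proof -
  let ?P = "PiM UNIV (\<lambda>i. gmeasure (\<alpha> i))"
  have "distr (mu_A \<alpha>) borel (\<lambda>x. x $ i) = distr ?P borel ((\<lambda>x. x $ i) \<circ> vec_lambda)"
    unfolding mu_A_eq_distr[where \<alpha>=\<alpha>, OF nonneg]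
    by (rule distr_distr) (auto intro: measurable_vec_lambda_PiM)
  also have "\<dots> = distr ?P (gmeasure (\<alpha> i)) (\<lambda>x. x i)"
    by (rule distr_cong) auto
  also have "\<dots> = gmeasure (\<alpha> i)"
    using distr_PiM_component[of UNIV "\<lambda>i. gmeasure (\<alpha> i)" i] prob_space_gmeasure[OF nonneg] by simp
  finally show ?thesis .
qed

lemma gmeasure_0: "gmeasure 0 = density lborel (\<lambda>x. ennreal (std_normal_density x))"
proof -
  have "(\<integral>y. gweight 0 y \<partial>lborel) = sqrt (2 * pi)"
    unfolding gweight_0 by simp
  then show ?thesis by (simp add: gmeasure_def gweight_0)
qed

lemma gmeasure_0_moments:
  "has_bochner_integral (gmeasure 0) (\<lambda>x. x) 0" "has_bochner_integral (gmeasure 0) (\<lambda>x. x\<^sup>2) 1"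
  using std_normal_moment_odd[of 0] std_normal_moment_even[of 1]
  unfolding gmeasure_0 by (auto intro!: has_bochner_integral_density simp: normal_density_nonneg)

text \<open>The truncations and their gradients converge pointwise, and dominated convergence
  upgrades this to L2. The moments are those of the standard normal, which is the law of the
  coordinate \<open>i\<close>.\<close>

lemma coordinate_in_X_A:
  fixes \<alpha> :: "'n::finite \<Rightarrow> real"
  assumes nonneg: "\<And>i. \<alpha> i \<ge> 0" and i: "\<alpha> i = 0"
  shows "(\<lambda>x. x $ i, \<lambda>x. axis i 1) \<in> X_A \<alpha>"
    "(\<integral>x. x $ i \<partial>mu_A \<alpha>) = 0" "(\<integral>x. (x $ i)\<^sup>2 \<partial>mu_A \<alpha>) = 1"
proof -
  interpret prob_space "mu_A \<alpha>" by (rule prob_space_mu_A[where \<alpha>=\<alpha>, OF nonneg])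
  note N = trunc_in_N_star[of \<alpha>, OF i]
  have gmeasure: "distr (mu_A \<alpha>) borel (\<lambda>x. x $ i) = gmeasure 0"
    using distr_mu_A_component[where \<alpha>=\<alpha>, OF nonneg, of i] by (simp add: i)
  have m: "(\<lambda>x. x $ i) \<in> measurable (mu_A \<alpha>) borel" by simp
  show "(\<integral>x. x $ i \<partial>mu_A \<alpha>) = 0"
    using integral_distr[OF m, of "\<lambda>t. t"] has_bochner_integral_integral_eq[OF gmeasure_0_moments(1)]
    unfolding gmeasure by simp
  show "(\<integral>x. (x $ i)\<^sup>2 \<partial>mu_A \<alpha>) = 1"
    using integral_distr[OF m, of "\<lambda>t. t\<^sup>2"] has_bochner_integral_integral_eq[OF gmeasure_0_moments(2)]
    unfolding gmeasure by simp
  have int: "integrable (mu_A \<alpha>) (\<lambda>x. (x $ i)\<^sup>2)"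
  proof (rule integrable_distr[OF m])
    show "integrable (distr (mu_A \<alpha>) borel (\<lambda>x. x $ i)) (\<lambda>t. t\<^sup>2)"
      unfolding gmeasure using gmeasure_0_moments(2) by (simp add: has_bochner_integral_iff)
  qed
  then have fin: "(\<integral>\<^sup>+x. ennreal ((x $ i)\<^sup>2) \<partial>mu_A \<alpha>) < \<infinity>"
    by (simp add: integrable_iff_bounded)
  have m1: "trunc i k \<in> borel_measurable (mu_A \<alpha>)" for k
    using borel_measurable_continuous_onI[OF N_star_bounded(3)[OF N]] by (simp cong: measurable_cong_sets)
  have m3: "grad (trunc i k) \<in> borel_measurable (mu_A \<alpha>)" for k
    using grad_measurable[OF N] by (simp cong: measurable_cong_sets)
  have "(\<lambda>k. \<integral>\<^sup>+ x. ennreal ((trunc i k x - x $ i)\<^sup>2) \<partial>mu_A \<alpha>) \<longlonglongrightarrow> (\<integral>\<^sup>+ x. 0 \<partial>mu_A \<alpha>)"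
  proof (rule nn_integral_dominated_convergence[where w="\<lambda>x. ennreal ((x $ i)\<^sup>2)"])
    have "(\<lambda>k. ennreal ((trunc i k x - x $ i)\<^sup>2)) \<longlonglongrightarrow> ennreal ((x $ i - x $ i)\<^sup>2)" for x :: "real^'n"
      by (intro tendsto_ennrealI tendsto_intros trunc_tendsto)
    then show "AE x in mu_A \<alpha>. (\<lambda>k. ennreal ((trunc i k x - x $ i)\<^sup>2)) \<longlonglongrightarrow> 0" by simp
  qed (use m1 fin in \<open>auto intro!: AE_I2 ennreal_leI trunc_error_le\<close>)
  moreover have "(\<lambda>k. \<integral>\<^sup>+ x. ennreal ((norm (grad (trunc i k) x - axis i 1))\<^sup>2) \<partial>mu_A \<alpha>) \<longlonglongrightarrow> (\<integral>\<^sup>+ x. 0 \<partial>mu_A \<alpha>)"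
  \<comment> \<open>Each partial derivative is at most \<open>1 + 48 * exp 1\<close> in absolute
    value and its limit at most 1; a constant is an admissible majorant on a probability
    space.\<close>
  proof (rule nn_integral_dominated_convergence[where w="\<lambda>x. ennreal (\<Sum>j\<in>(UNIV::'n set). (2 + 48 * exp 1)\<^sup>2)"])
    have eq: "(norm (grad (trunc i k) x - axis i 1))\<^sup>2 = (\<Sum>j\<in>UNIV. (pderiv_i j (trunc i k) x - (if j = i then 1 else 0))\<^sup>2)" for k x
      by (auto simp: norm_vec_square grad_def axis_def intro!: sum.cong)
    have "(\<lambda>k. ennreal ((norm (grad (trunc i k) x - axis i 1))\<^sup>2)) \<longlonglongrightarrow> ennreal (\<Sum>j\<in>(UNIV::'n set). ((if j = i then 1 else 0) - (if j = i then 1 else 0))\<^sup>2)" for x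
      unfolding eq by (intro tendsto_ennrealI tendsto_intros pderiv_trunc_tendsto)
    then show "AE x in mu_A \<alpha>. (\<lambda>k. ennreal ((norm (grad (trunc i k) x - axis i 1))\<^sup>2)) \<longlonglongrightarrow> 0" by simp
    show "AE x in mu_A \<alpha>. ennreal ((norm (grad (trunc i k) x - axis i 1))\<^sup>2) \<le> ennreal (\<Sum>j\<in>(UNIV::'n set). (2 + 48 * exp 1)\<^sup>2)" for k
    proof (intro AE_I2 ennreal_leI, unfold eq, rule sum_mono)
      fix x j
      have "\<bar>pderiv_i j (trunc i k) x - (if j = i then 1 else 0)\<bar> \<le> 2 + 48 * exp 1"
        using pderiv_trunc_le[of j i k x] by auto
      then show "(pderiv_i j (trunc i k) x - (if j = i then 1 else 0))\<^sup>2 \<le> (2 + 48 * exp 1)\<^sup>2"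
        by (subst abs_le_square_iff[symmetric]) simp
    qed
  qed (use m3 in \<open>auto simp: emeasure_space_1[simplified] ennreal_mult_less_top\<close>)
  ultimately show "(\<lambda>x. x $ i, \<lambda>x. axis i 1) \<in> X_A \<alpha>"
    using fin N emeasure_space_1 unfolding X_A_def by (auto intro!: exI[of _ "trunc i"])
qed

theorem theorem1p2:
  fixes \<alpha> :: "'n::finite \<Rightarrow> real"
  assumes nonneg: "\<And>i. \<alpha> i \<ge> 0"
  shows "(\<forall>(u, g)\<in>X_A \<alpha>.
            (\<integral>x. (norm (g x))\<^sup>2 \<partial>mu_A \<alpha>) \<ge>
            (\<integral>x. (u x - (\<integral>y. u y \<partial>mu_A \<alpha>))\<^sup>2 \<partial>mu_A \<alpha>))
       \<and> ((\<exists>i. \<alpha> i = 0) \<longrightarrow>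
           (\<exists>(u, g)\<in>X_A \<alpha>. \<not> (\<exists>c. AE x in mu_A \<alpha>. u x = c) \<and>
              (\<integral>x. (norm (g x))\<^sup>2 \<partial>mu_A \<alpha>) =
              (\<integral>x. (u x - (\<integral>y. u y \<partial>mu_A \<alpha>))\<^sup>2 \<partial>mu_A \<alpha>)))"
proof (intro conjI impI)
  show "\<forall>(u, g)\<in>X_A \<alpha>. (\<integral>x. (norm (g x))\<^sup>2 \<partial>mu_A \<alpha>) \<ge>
            (\<integral>x. (u x - (\<integral>y. u y \<partial>mu_A \<alpha>))\<^sup>2 \<partial>mu_A \<alpha>)"
    using poincare_X_A[where \<alpha>=\<alpha>, OF nonneg] by blast
next
  assume "\<exists>i. \<alpha> i = 0"
  then obtain i where i: "\<alpha> i = 0" by blast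
  interpret prob_space "mu_A \<alpha>" by (rule prob_space_mu_A[where \<alpha>=\<alpha>, OF nonneg])
  note c = coordinate_in_X_A[where \<alpha>=\<alpha>, OF nonneg i]
  have "\<not> (AE x in mu_A \<alpha>. x $ i = c)" for c
  proof
    assume ae: "AE x in mu_A \<alpha>. x $ i = c"
    \<comment> \<open>By the first two moments an almost everywhere constant value \<open>c\<close>
      would satisfy both \<open>c = 0\<close> and \<open>c\<^sup>2 = 1\<close>.\<close>
    have "(\<integral>x. x $ i \<partial>mu_A \<alpha>) = (\<integral>x. c \<partial>mu_A \<alpha>)" "(\<integral>x. (x $ i)\<^sup>2 \<partial>mu_A \<alpha>) = (\<integral>x. c\<^sup>2 \<partial>mu_A \<alpha>)"
      by (rule integral_cong_AE; use ae in auto)+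
    then show False using c prob_space by simp
  qed
  moreover have "(\<integral>x. (norm (axis i 1 :: real^'n))\<^sup>2 \<partial>mu_A \<alpha>) =
      (\<integral>x. (x $ i - (\<integral>y. y $ i \<partial>mu_A \<alpha>))\<^sup>2 \<partial>mu_A \<alpha>)"
    using c prob_space by simp
  ultimately show "\<exists>(u, g)\<in>X_A \<alpha>. \<not> (\<exists>c. AE x in mu_A \<alpha>. u x = c) \<and>
              (\<integral>x. (norm (g x))\<^sup>2 \<partial>mu_A \<alpha>) =
              (\<integral>x. (u x - (\<integral>y. u y \<partial>mu_A \<alpha>))\<^sup>2 \<partial>mu_A \<alpha>)"
    using c(1) by (intro bexI[of _ "(\<lambda>x. x $ i, \<lambda>x. axis i 1)"]) auto
qed

end
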